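(* Let $n\in\mathbb N$ ($n\ge1$), $s\in(0,1]$, $\gamma>0$ and $1<p<1+\frac{4}{n+2\gamma}$. Assume that the initial data $(u_0,u_1)\in(H^s\cap\dot H^{-\gamma})\times(L^2\cap\dot H^{-\gamma})$ satisfy $\widehat{u_0+u_1}\ge0$ and, for some $r>0$ and some constant $c>0$, $$\widehat{u_0+u_1}(\xi)\ \ge\ c\,|\xi|^{-\frac n2+\gamma}\left(\log(|\xi|^{-1})\right)^{-1}\chi_{|\cdot|<r}(\xi)\quad\text{for a.e. }\xi\in\mathbb R^n.$$ Then, for all sufficiently small $\varepsilon>0$, the Cauchy problem $$\partial_t^2u+\partial_tu-\Delta u=|u|^p\quad (x\in\mathbb R^n,\ t>0),\qquad u(0,x)=\varepsilon u_0(x),\quad \partial_tu(0,x)=\varepsilon u_1(x)$$ has no global (in time) weak solution. Moreover, for every sufficiently small $\delta>0$ there is a constant $C>0$ independent of $\varepsilon$ such that, for all sufficiently small $\varepsilon>0$, the lifespan $T$ of the local solution satisfies $$T\le C\,\varepsilon^{-\frac{1}{p'-1-\frac\gamma2-\frac n4-\delta}}.$$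
   Context: All function spaces are on $\mathbb R^n$. $\hat f$ is the Fourier transform, $H^s$ the usual inhomogeneous Sobolev space, $\|f\|_{\dot H^{-\gamma}}:=\||\xi|^{-\gamma}\hat f\|_{L^2}$ and $\dot H^{-\gamma}:=\{f:\|f\|_{\dot H^{-\gamma}}<\infty\}$. $p'$ is the conjugate exponent, $1/p+1/p'=1$. $\chi_{|\cdot|<r}$ is the characteristic function of the ball $\{\xi\in\mathbb R^n:|\xi|<r\}$. Weak solution: for $0<T\le\infty$, a weak solution on $[0,T)$ is a function $u\in L^p_{\mathrm{loc}}([0,T)\times\mathbb R^n)$ such that for every $\psi\in C_0^\infty([0,T)\times\mathbb R^n)$ $$\int_0^T\!\!\int_{\mathbb R^n}|u|^p\psi\,dx\,dt+\varepsilon\int_{\mathbb R^n}(u_0+u_1)\psi(0,x)\,dx-\varepsilon\int_{\mathbb R^n}u_0\,\partial_t\psi(0,x)\,dx=\int_0^T\!\!\int_{\mathbb R^n}u\,(\partial_t^2-\partial_t-\Delta)\psi\,dx\,dt.$$ It is global if $T=\infty$. The lifespan estimate means that the bound holds for every $T$ such that a weak solution exists on $[0,T)$. *)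

theory Defs
  imports "HOL-Analysis.Analysis"
begin

definition L2_space :: "('a::euclidean_space \<Rightarrow> complex) set" where
  "L2_space = {f. f \<in> borel_measurable lebesgue \<and> integrable lebesgue (\<lambda>x. (cmod (f x))\<^sup>2)}"

(* The Fourier transform of an L^2 function in the sense of Plancherel: the limit in L^2, as R
   tends to infinity, of the Fourier integrals of f restricted to the ball of radius R.  It is a
   relation because the transform is determined only almost everywhere.  The unitary
   normalisation is used.  The distance is a nonnegative integral, so that convergence to 0
   cannot hold through the default value 0 of a Bochner integral. *)

definition truncated_fourier :: "real \<Rightarrow> ('a::euclidean_space \<Rightarrow> complex) \<Rightarrow> 'a \<Rightarrow> complex" where
  "truncated_fourier R f \<xi> =
     of_real ((2 * pi) powr (- real DIM('a) / 2)) *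
     (LINT x:cball 0 R|lebesgue. exp (- (\<i> * of_real (x \<bullet> \<xi>))) * f x)"

definition has_fourier_transform ::
  "('a::euclidean_space \<Rightarrow> complex) \<Rightarrow> ('a \<Rightarrow> complex) \<Rightarrow> bool" where
  "has_fourier_transform f g \<longleftrightarrow>
     f \<in> L2_space \<and> g \<in> L2_space \<and>
     ((\<lambda>R. \<integral>\<^sup>+ \<xi>. ennreal ((cmod (g \<xi> - truncated_fourier R f \<xi>))\<^sup>2) \<partial>lebesgue) \<longlongrightarrow> 0) at_top"

(* H^s for s \<ge> 0. *)
definition sobolev :: "real \<Rightarrow> ('a::euclidean_space \<Rightarrow> complex) set" where
  "sobolev s = {f. \<exists>g. has_fourier_transform f g \<and>
     (\<lambda>\<xi>. of_real ((1 + (norm \<xi>)\<^sup>2) powr (s / 2)) * g \<xi>) \<in> L2_space}"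

(* The part of the homogeneous space of order -\<gamma> that lies in L^2.  The full space also contains
   tempered distributions outside L^2, which have no role where it is intersected with L^2 or
   with H^s, s \<ge> 0. *)
definition hom_sobolev_neg :: "real \<Rightarrow> ('a::euclidean_space \<Rightarrow> complex) set" where
  "hom_sobolev_neg \<gamma> = {f. \<exists>g. has_fourier_transform f g \<and>
     (\<lambda>\<xi>. of_real (norm \<xi> powr (- \<gamma>)) * g \<xi>) \<in> L2_space}"

definition dir_deriv :: "'a::real_normed_vector \<Rightarrow> ('a \<Rightarrow> real) \<Rightarrow> 'a \<Rightarrow> real" where
  "dir_deriv v f z = frechet_derivative f (at z) v"

primrec Ck :: "nat \<Rightarrow> ('a::real_normed_vector \<Rightarrow> real) \<Rightarrow> bool" where
  "Ck 0 f \<longleftrightarrow> continuous_on UNIV f"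
| "Ck (Suc k) f \<longleftrightarrow> (\<forall>z. f differentiable (at z)) \<and> (\<forall>v. Ck k (dir_deriv v f))"

definition smooth :: "('a::real_normed_vector \<Rightarrow> real) \<Rightarrow> bool" where
  "smooth f \<longleftrightarrow> (\<forall>k. Ck k f)"

definition time_deriv ::
  "(real \<times> 'a::euclidean_space \<Rightarrow> real) \<Rightarrow> real \<times> 'a \<Rightarrow> real" where
  "time_deriv \<psi> = dir_deriv (1, 0) \<psi>"

definition laplacian ::
  "(real \<times> 'a::euclidean_space \<Rightarrow> real) \<Rightarrow> real \<times> 'a \<Rightarrow> real" where
  "laplacian \<psi> z = (\<Sum>b\<in>Basis. dir_deriv (0, b) (dir_deriv (0, b) \<psi>) z)"

definition time_strip :: "ereal \<Rightarrow> (real \<times> 'a) set" where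
  "time_strip T = {(t, x). 0 \<le> t \<and> ereal t < T}"

(* Elements of C_0^\<infinity>([0,T) \<times> R^n) need not vanish at t = 0.  They are represented by extensions to
   C_0^\<infinity>((-\<infinity>,T) \<times> R^n); only the values for t \<ge> 0 enter below. *)
definition test_function :: "ereal \<Rightarrow> (real \<times> 'a::euclidean_space \<Rightarrow> real) \<Rightarrow> bool" where
  "test_function T \<psi> \<longleftrightarrow> smooth \<psi> \<and>
     (\<exists>K. compact K \<and> (\<forall>(t, x)\<in>K. ereal t < T) \<and> (\<forall>z. z \<notin> K \<longrightarrow> \<psi> z = 0))"

definition Lp_loc :: "real \<Rightarrow> 'b::euclidean_space set \<Rightarrow> ('b \<Rightarrow> complex) set" where
  "Lp_loc p S = {u. u \<in> borel_measurable (lebesgue_on S) \<and>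
     (\<forall>K. compact K \<and> K \<subseteq> S \<longrightarrow> set_integrable lebesgue K (\<lambda>z. cmod (u z) powr p))}"

(* By complex linearity of the identity in \<psi>, real test functions give the same notion as
   complex ones. *)
definition weak_solution ::
  "real \<Rightarrow> real \<Rightarrow> ('a::euclidean_space \<Rightarrow> complex) \<Rightarrow> ('a \<Rightarrow> complex) \<Rightarrow> ereal \<Rightarrow>
   (real \<times> 'a \<Rightarrow> complex) \<Rightarrow> bool" where
  "weak_solution p \<epsilon> u0 u1 T u \<longleftrightarrow>
     u \<in> Lp_loc p (time_strip T) \<and>
     (\<forall>\<psi>. test_function T \<psi> \<longrightarrow>
        (LINT z:time_strip T|lebesgue. of_real (cmod (u z) powr p * \<psi> z))
        + of_real \<epsilon> * (LINT x|lebesgue. (u0 x + u1 x) * of_real (\<psi> (0, x)))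
        - of_real \<epsilon> * (LINT x|lebesgue. u0 x * of_real (time_deriv \<psi> (0, x)))
        = (LINT z:time_strip T|lebesgue.
             u z * of_real (time_deriv (time_deriv \<psi>) z - time_deriv \<psi> z - laplacian \<psi> z)))"

end

theory Submission
  imports Defs "HOL-Probability.Sinc_Integral"
begin

text \<open>
  Test the equation with \<open>\<psi>\<^sub>R(t, x) = \<Phi>(t / R, x / \<surd>R)\<^sup>k\<close>, where \<open>\<Phi>\<close> is a tensor product of copies
  of one smooth even bump \<open>H\<close> on the line.  For large \<open>k\<close> the wave-damping operator applied to
  \<open>\<psi>\<^sub>R\<close> is at most \<open>C R\<^sup>-\<^sup>1 \<psi>\<^sub>R powr (1 / p)\<close>, so that Young's inequality absorbs the nonlinear term and leaves
  \<open>\<epsilon> \<integral> (u\<^sub>0 + u\<^sub>1) \<psi>\<^sub>R(0, \<cdot>) \<le> C R powr (1 - p' + n / 2)\<close>; the term with \<open>\<partial>\<^sub>t \<psi>\<^sub>R(0, \<cdot>)\<close> vanishes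
  because \<open>H\<close> is even.  The data are only controlled on the Fourier side, hence \<open>H\<close> is chosen to be the Fourier
  integral of a nonnegative density that is positive near \<open>0\<close>.  Then the data integral pairs the nonnegative transform
  with a nonnegative density, and frequencies of size \<open>R powr (- 1 / 2)\<close> alone contribute
  \<open>R powr (n / 4 - \<gamma> / 2) / ln R\<close>.  Comparing the powers of \<open>R\<close> bounds \<open>R\<close>, and with it the lifespan.

  The bump is \<open>H(x) = \<integral> cos (x \<xi>) G(\<xi>) d\<xi>\<close> with \<open>G(\<xi>) = \<Prod>\<^sub>k sinc\<^sup>2(\<xi> / 2 ^ k)\<close>, up to normalisation: the
  product decays faster than every power, and every factor only enlarges the support by a summable amount.
\<close>

section \<open>A smooth bump with nonnegative Fourier transform\<close>

text \<open>The obstacle is that \<open>u0 + u1\<close> has no sign and need not be integrable: only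
  its L^2 transform is bounded below, and only near frequency 0. The transform of an arbitrary
  cutoff may change sign, and then such a bound yields nothing. A nonnegative density survives both
  operations that the test functions require: \<open>H ^ k\<close> has a convolution power of it as
  density, and a dilation only concentrates it. So one bump serves both sides: the power
  \<open>k\<close> pays for the derivatives in Young's inequality, and positivity lets all
  frequencies outside a small cube be discarded. The exponents come from \<epsilon> R^(n/4 -
  \<gamma>/2) / ln R \<le> C R^(1 - p' + n/2). As p' - 1 = 1/(p - 1), the assumption p < 1 + 4/(n +
  2\<gamma>) says exactly that p' - 1 - \<gamma>/2 - n/4 is positive, so that R is bounded. The
  logarithm costs an arbitrarily small power of R, which is the \<delta> of the lifespan
  estimate.\<close>

lemma integrable_tensor:
  fixes f :: "'a \<Rightarrow> 'c::{real_normed_field, banach, second_countable_topology}" and g :: "'b \<Rightarrow> 'c"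
  assumes "pair_sigma_finite M N" "integrable M f" "integrable N g"
  shows "integrable (M \<Otimes>\<^sub>M N) (\<lambda>(x, y). f x * g y)"
proof -
  interpret pair_sigma_finite M N by fact
  have [measurable]: "f \<in> borel_measurable M" "g \<in> borel_measurable N" using assms by auto
  show ?thesis
    using assms(2,3)
    by (intro Fubini_integrable) (auto simp: norm_mult)
qed

section \<open>The cardinal sine: bounds and integrability\<close>

definition sincard :: "real \<Rightarrow> real" where
  "sincard x = (if x = 0 then 1 else sin x / x)"

lemma sincard_measurable [measurable]: "sincard \<in> borel_measurable borel"
  unfolding sincard_def by measurable

lemma abs_sincard_le: "\<bar>sincard x\<bar> \<le> 1"
  using abs_sin_x_le_abs_x[of x] by (auto simp: sincard_def)

lemma sincard_sq_le: "(sincard x)\<^sup>2 \<le> 1"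
  using abs_sincard_le[of x] by (simp add: abs_square_le_1)

lemma sincard_minus [simp]: "sincard (- x) = sincard x"
  by (simp add: sincard_def)

lemma cos_ge: "cos x \<ge> 1 - x\<^sup>2 / 2" for x :: real
proof -
  have "cos x = 1 - 2 * (sin (x/2))\<^sup>2"
    using cos_double_sin[of "x/2"] by simp
  moreover have "(sin (x/2))\<^sup>2 \<le> (x/2)\<^sup>2"
    using abs_sin_x_le_abs_x[of "x/2"] by (simp only: abs_le_square_iff)
  ultimately show ?thesis by (simp add: power_divide)
qed

text \<open>By the mean value theorem sinc y = cos z for some z between 0 and y, and cos^2 z = 1 -
  sin^2 z. The quadratic deviation from 1 is what makes the dyadic product below stay away from 0
  near the origin.\<close>

lemma sincard_sq_ge: "(sincard x)\<^sup>2 \<ge> 1 - x\<^sup>2"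
proof -
  have pos: "(sincard y)\<^sup>2 \<ge> 1 - y\<^sup>2" if "y > 0" for y
  proof -
    obtain z where z: "0 < z" "z < y" "sin y - sin 0 = (y - 0) * cos z"
      using MVT2[of 0 y sin cos] \<open>y > 0\<close> by (auto intro: derivative_eq_intros)
    then have eq: "sincard y = cos z" using that by (simp add: sincard_def)
    have "(sincard y)\<^sup>2 = 1 - (sin z)\<^sup>2" by (simp add: eq cos_squared_eq)
    moreover have "(sin z)\<^sup>2 \<le> z\<^sup>2"
      using abs_sin_x_le_abs_x[of z] by (simp add: abs_le_square_iff)
    moreover have "z\<^sup>2 \<le> y\<^sup>2" using z by (intro power_mono) auto
    ultimately show ?thesis by simp
  qed
  show ?thesis
    using pos[of x] pos[of "-x"] by (cases x "0::real" rule: linorder_cases) (auto simp: sincard_def)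
qed

lemma integrable_inverse_one_plus_sq: "integrable lborel (\<lambda>x::real. 1 / (1 + x\<^sup>2))"
  using integrable_inverse_1_plus_square
  by (simp add: set_integrable_def einterval_eq_UNIV inverse_eq_divide)

lemma integrable_sincard_sq: "integrable lborel (\<lambda>x. (sincard x)\<^sup>2)"
proof (rule Bochner_Integration.integrable_bound)
  show "integrable lborel (\<lambda>x::real. 2 * (1 / (1 + x\<^sup>2)))"
    by (intro integrable_mult_right integrable_inverse_one_plus_sq)
  have "(sincard x)\<^sup>2 * (1 + x\<^sup>2) \<le> 2" for x
  proof -
    have "(sincard x)\<^sup>2 * x\<^sup>2 \<le> 1"
      by (simp add: sincard_def power_divide abs_square_le_1)
    then show ?thesis using sincard_sq_le[of x] by (simp add: algebra_simps)
  qed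
  then show "AE x in lborel. norm ((sincard x)\<^sup>2) \<le> norm (2 * (1 / (1 + x\<^sup>2)))"
    by (intro AE_I2) (simp add: field_simps add_pos_nonneg)
qed measurable

text \<open>
  The transform of \<open>sinc\<^sup>2\<close> is a combination of the integrals below; homogeneity in \<open>y\<close> suffices to see that
  it is a tent function, so their value at \<open>y = 1\<close> is not needed.
\<close>

definition one_minus_cos :: "real \<Rightarrow> real \<Rightarrow> real" where
  "one_minus_cos y x = (1 - cos (y * x)) / x\<^sup>2"

lemma one_minus_cos_measurable [measurable]: "one_minus_cos y \<in> borel_measurable borel"
  unfolding one_minus_cos_def by measurable

lemma integrable_one_minus_cos: "integrable lborel (one_minus_cos y)"
proof (rule Bochner_Integration.integrable_bound)
  show "integrable lborel (\<lambda>x::real. (y\<^sup>2 / 2 + 2) * (1 / (1 + x\<^sup>2)))"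
    by (intro integrable_mult_right integrable_inverse_one_plus_sq)
  have "\<bar>one_minus_cos y x\<bar> * (1 + x\<^sup>2) \<le> y\<^sup>2 / 2 + 2" for x
  proof (cases "x = 0")
    case False
    have "1 - cos (y * x) \<le> (y * x)\<^sup>2 / 2" using cos_ge[of "y * x"] by simp
    then have "one_minus_cos y x \<le> y\<^sup>2 / 2"
      using False by (simp add: one_minus_cos_def field_simps)
    moreover have "0 \<le> one_minus_cos y x" by (simp add: one_minus_cos_def)
    moreover have "one_minus_cos y x * x\<^sup>2 \<le> 2"
      using False cos_ge_minus_one[of "y * x"] by (simp add: one_minus_cos_def)
    ultimately show ?thesis by (simp add: algebra_simps)
  qed (simp add: one_minus_cos_def)
  then show "AE x in lborel. norm (one_minus_cos y x) \<le> norm ((y\<^sup>2 / 2 + 2) * (1 / (1 + x\<^sup>2)))"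
    by (intro AE_I2) (simp add: field_simps add_pos_nonneg)
qed measurable

lemma integral_one_minus_cos:
  "(\<integral>x. one_minus_cos y x \<partial>lborel) = \<bar>y\<bar> * (\<integral>x. one_minus_cos 1 x \<partial>lborel)"
proof (cases "y = 0")
  case False
  have "(\<integral>x. one_minus_cos 1 x \<partial>lborel) = \<bar>y\<bar> *\<^sub>R (\<integral>x. one_minus_cos 1 (0 + y * x) \<partial>lborel)"
    by (rule lborel_integral_real_affine) (use False in auto)
  also have "(\<lambda>x. one_minus_cos 1 (0 + y * x)) = (\<lambda>x. one_minus_cos y x / y\<^sup>2)"
    using False by (auto simp: one_minus_cos_def power_mult_distrib)
  also have "\<bar>y\<bar> *\<^sub>R (\<integral>x. one_minus_cos y x / y\<^sup>2 \<partial>lborel) = \<bar>y\<bar> * ((\<integral>x. one_minus_cos y x \<partial>lborel) / y\<^sup>2)"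
    by simp
  also have "\<dots> = (\<integral>x. one_minus_cos y x \<partial>lborel) / \<bar>y\<bar>"
    using False by (simp add: power2_eq_square abs_if)
  finally have "(\<integral>x. one_minus_cos 1 x \<partial>lborel) = (\<integral>x. one_minus_cos y x \<partial>lborel) / \<bar>y\<bar>" .
  then show ?thesis using False by simp
qed (simp add: one_minus_cos_def)

text \<open>For even densities this is the Fourier integral, so sign and support can be studied over
  the reals.\<close>

definition cos_transform :: "(real \<Rightarrow> real) \<Rightarrow> real \<Rightarrow> real" where
  "cos_transform F x = (\<integral>\<xi>. cos (x * \<xi>) * F \<xi> \<partial>lborel)"

text \<open>The phase \<open>a\<close> covers sines as well, and with multiples of pi/2 all
  derivatives of a cosine transform.\<close>

lemma integrable_cos_mult:
  assumes "integrable lborel (F :: real \<Rightarrow> real)"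
  shows "integrable lborel (\<lambda>\<xi>. cos (x * \<xi> + a) * F \<xi>)"
proof -
  have [measurable]: "F \<in> borel_measurable borel" using borel_measurable_integrable[OF assms] by simp
  show ?thesis
    using assms
    by (rule Bochner_Integration.integrable_bound) (auto simp: abs_mult intro!: mult_left_le_one_le)
qed

text \<open>The bump is the transform of \<open>F\<close>, not \<open>F\<close> itself. The property
  is stated for the density because the construction multiplies densities.\<close>

definition bump_transform :: "real \<Rightarrow> (real \<Rightarrow> real) \<Rightarrow> bool" where
  "bump_transform A F \<longleftrightarrow> integrable lborel F \<and>
     (\<forall>x. 0 \<le> cos_transform F x) \<and> (\<forall>x. \<bar>x\<bar> \<ge> A \<longrightarrow> cos_transform F x = 0)"

text \<open>Product-to-sum formulas turn the transform into a second difference, with step 2, of a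
  multiple of the convex function |x|. This is a tent: nonnegative by convexity, and zero where |x|
  is affine on [x - 2, x + 2].\<close>

lemma bump_transform_sincard_sq: "bump_transform 2 (\<lambda>\<xi>. (sincard \<xi>)\<^sup>2)"
proof -
  let ?J = "\<integral>x. one_minus_cos 1 x \<partial>lborel"
  have J: "0 \<le> ?J" by (intro Bochner_Integration.integral_nonneg) (simp add: one_minus_cos_def)
  have eq: "cos_transform (\<lambda>\<xi>. (sincard \<xi>)\<^sup>2) x = ?J * (\<bar>x + 2\<bar> / 4 + \<bar>x - 2\<bar> / 4 - \<bar>x\<bar> / 2)" for x
  proof -
    let ?f = "\<lambda>\<xi>. one_minus_cos (x + 2) \<xi> / 4 + one_minus_cos (x - 2) \<xi> / 4 - one_minus_cos x \<xi> / 2"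
    \<comment> \<open>At \<xi> = 0 the left side is 1 while division by zero makes the right side 0;
      the identity is therefore used almost everywhere.\<close>
    have pw: "cos (x * \<xi>) * (sincard \<xi>)\<^sup>2 = ?f \<xi>" if "\<xi> \<noteq> 0" for \<xi>
    proof -
      have "cos (x * \<xi>) * (sin \<xi>)\<^sup>2 =
        (1 - cos ((x + 2) * \<xi>)) / 4 + (1 - cos ((x - 2) * \<xi>)) / 4 - (1 - cos (x * \<xi>)) / 2"
      proof -
        have "cos ((x + 2) * \<xi>) + cos ((x - 2) * \<xi>) = 2 * cos (x * \<xi>) * cos (2 * \<xi>)"
          by (simp add: cos_add cos_diff algebra_simps)
        also have "cos (2 * \<xi>) = 1 - 2 * (sin \<xi>)\<^sup>2" by (rule cos_double_sin)
        finally have "cos ((x + 2) * \<xi>) + cos ((x - 2) * \<xi>) = 2 * cos (x * \<xi>) - 4 * (cos (x * \<xi>) * (sin \<xi>)\<^sup>2)"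
          by (simp add: algebra_simps)
        then show ?thesis by (simp add: field_simps)
      qed
      then have "cos (x * \<xi>) * ((sin \<xi>)\<^sup>2 / \<xi>\<^sup>2) =
        ((1 - cos ((x + 2) * \<xi>)) / 4 + (1 - cos ((x - 2) * \<xi>)) / 4 - (1 - cos (x * \<xi>)) / 2) / \<xi>\<^sup>2"
        by simp
      then show ?thesis using that
        by (simp add: sincard_def one_minus_cos_def power_divide add_divide_distrib diff_divide_distrib)
    qed
    have "cos_transform (\<lambda>\<xi>. (sincard \<xi>)\<^sup>2) x = (\<integral>\<xi>. ?f \<xi> \<partial>lborel)"
      unfolding cos_transform_def
      using AE_lborel_singleton[of 0] by (intro integral_cong_AE) (auto elim!: eventually_mono simp: pw)
    also have "\<dots> = ?J * (\<bar>x + 2\<bar> / 4 + \<bar>x - 2\<bar> / 4 - \<bar>x\<bar> / 2)"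
      using integral_one_minus_cos[of "x+2"] integral_one_minus_cos[of "x-2"] integral_one_minus_cos[of x]
      by (simp add: integrable_one_minus_cos algebra_simps)
    finally show ?thesis .
  qed
  have "0 \<le> \<bar>x + 2\<bar> / 4 + \<bar>x - 2\<bar> / 4 - \<bar>x\<bar> / 2" for x :: real
    by (auto simp: abs_if field_simps)
  moreover have "\<bar>x + 2\<bar> / 4 + \<bar>x - 2\<bar> / 4 - \<bar>x\<bar> / 2 = 0" if "2 \<le> \<bar>x\<bar>" for x :: real
    using that by (auto simp: abs_if field_simps split: if_splits)
  ultimately show ?thesis
    unfolding bump_transform_def eq using J integrable_sincard_sq by simp
qed

lemma integral_cos_translate:
  assumes "a > 0"
  shows "(\<integral>y. indicator {-a..a} y * cos ((x + y) * \<xi>) \<partial>lborel) = 2 * a * (cos (x * \<xi>) * sincard (a * \<xi>))"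
proof (cases "\<xi> = 0")
  case True
  then show ?thesis using assms by (simp add: sincard_def)
next
  case False
  have "(\<integral>y. indicator {-a..a} y *\<^sub>R cos ((x + y) * \<xi>) \<partial>lborel) = sin ((x + a) * \<xi>) / \<xi> - sin ((x + - a) * \<xi>) / \<xi>"
    by (rule integral_FTC_atLeastAtMost[of "-a" a "\<lambda>y. sin ((x + y) * \<xi>) / \<xi>"])
      (use assms False in \<open>auto intro!: derivative_eq_intros continuous_intros
         simp flip: has_real_derivative_iff_has_vector_derivative\<close>)
  then show ?thesis using False assms
    by (simp add: sincard_def field_simps sin_add sin_diff)
qed

text \<open>The mean of cos((x + y) \<xi>) over y in [-a, a] is cos(x \<xi>) sinc(a \<xi>), so a
  factor sinc on the density is a moving average of the transform. Fubini applies because the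
  interval is bounded and \<open>F\<close> is integrable.\<close>

lemma cos_transform_sincard_mult:
  assumes "a > 0" and F: "integrable lborel F"
  shows "cos_transform (\<lambda>\<xi>. sincard (a * \<xi>) * F \<xi>) x =
    (\<integral>y. indicator {-a..a} y * cos_transform F (x + y) \<partial>lborel) / (2 * a)"
proof -
  let ?f = "\<lambda>y \<xi>. indicator {-a..a} y * cos ((x + y) * \<xi>) * F \<xi>"
  have [measurable]: "F \<in> borel_measurable borel" using borel_measurable_integrable[OF F] by simp
  have int: "integrable (lborel \<Otimes>\<^sub>M lborel) (\<lambda>(y, \<xi>). ?f y \<xi>)"
  proof (rule Bochner_Integration.integrable_bound)
    show "integrable (lborel \<Otimes>\<^sub>M lborel) (\<lambda>(y, \<xi>). indicator {-a..a} y * F \<xi>)"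
      by (rule integrable_tensor) (use F lborel_pair.pair_sigma_finite_axioms in \<open>auto intro!: integrable_real_indicator simp: emeasure_lborel_Icc_eq\<close>)
    show "AE z in lborel \<Otimes>\<^sub>M lborel. norm (case z of (y, \<xi>) \<Rightarrow> ?f y \<xi>)
        \<le> norm (case z of (y, \<xi>) \<Rightarrow> indicator {-a..a} y * F \<xi>)"
      by (intro AE_I2) (auto simp: abs_mult split: split_indicator intro!: mult_left_le_one_le)
  qed measurable
  have "(\<integral>y. indicator {-a..a} y * cos_transform F (x + y) \<partial>lborel) = (\<integral>y. \<integral>\<xi>. ?f y \<xi> \<partial>lborel \<partial>lborel)"
    unfolding cos_transform_def by (simp add: mult.assoc)
  also have "\<dots> = (\<integral>\<xi>. \<integral>y. ?f y \<xi> \<partial>lborel \<partial>lborel)"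
    using lborel_pair.Fubini_integral[OF int] by simp
  also have "\<dots> = (\<integral>\<xi>. 2 * a * (cos (x * \<xi>) * (sincard (a * \<xi>) * F \<xi>)) \<partial>lborel)"
    by (simp only: integral_mult_left_zero integral_cos_translate[OF assms(1)]) (simp only: mult.assoc)
  also have "\<dots> = 2 * a * cos_transform (\<lambda>\<xi>. sincard (a * \<xi>) * F \<xi>) x"
    by (simp add: cos_transform_def)
  finally show ?thesis using assms by simp
qed

text \<open>A moving average over [x - a, x + a] keeps nonnegativity and widens the support by
  \<open>a\<close> on each side.\<close>

lemma bump_transform_sincard_mult:
  assumes "a > 0" and F: "bump_transform A F"
  shows "bump_transform (A + a) (\<lambda>\<xi>. sincard (a * \<xi>) * F \<xi>)"
proof -
  have F': "integrable lborel F" "\<And>x. 0 \<le> cos_transform F x" "\<And>x. A \<le> \<bar>x\<bar> \<Longrightarrow> cos_transform F x = 0"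
    using F by (auto simp: bump_transform_def)
  have [measurable]: "F \<in> borel_measurable borel" using borel_measurable_integrable[OF F'(1)] by simp
  have "integrable lborel (\<lambda>\<xi>. sincard (a * \<xi>) * F \<xi>)"
    using F'(1) by (rule Bochner_Integration.integrable_bound)
      (auto simp: abs_mult abs_sincard_le intro!: mult_left_le_one_le)
  moreover have "(\<integral>y. indicator {-a..a} y * cos_transform F (x + y) \<partial>lborel) = 0" if "A + a \<le> \<bar>x\<bar>" for x
  proof -
    have "indicator {-a..a} y * cos_transform F (x + y) = 0" for y
      using F'(3)[of "x + y"] that by (auto split: split_indicator)
    then show ?thesis by (simp only: integral_zero)
  qed
  ultimately show ?thesis
    using assms F' unfolding bump_transform_def cos_transform_sincard_mult[OF assms(1) F'(1)]
    by (auto intro!: divide_nonneg_nonneg Bochner_Integration.integral_nonneg mult_nonneg_nonneg)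
qed

section \<open>Dyadic products of squared sinc functions and their limit\<close>

definition sincard_prod :: "nat \<Rightarrow> real \<Rightarrow> real" where
  "sincard_prod m \<xi> = (\<Prod>k<m. (sincard (\<xi> / 2 ^ k))\<^sup>2)"

lemma sincard_prod_measurable [measurable]: "sincard_prod m \<in> borel_measurable borel"
  unfolding sincard_prod_def by measurable

lemma sincard_prod_Suc: "sincard_prod (Suc m) \<xi> = (sincard (\<xi> / 2 ^ m))\<^sup>2 * sincard_prod m \<xi>"
  by (simp add: sincard_prod_def mult.commute)

lemma sincard_prod_nonneg: "0 \<le> sincard_prod m \<xi>"
  by (simp add: sincard_prod_def prod_nonneg)

lemma decseq_sincard_prod: "decseq (\<lambda>m. sincard_prod m \<xi>)"
  by (rule decseq_SucI)
    (auto simp: sincard_prod_Suc sincard_prod_nonneg sincard_sq_le intro!: mult_left_le_one_le)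

lemma sincard_prod_minus [simp]: "sincard_prod m (- \<xi>) = sincard_prod m \<xi>"
  by (simp add: sincard_prod_def)

text \<open>The factor with index 0 has radius 2, and each later squared factor is two averages of
  half-width 2^(-k). The radii add up to 2 + 2 (2^(-1) + ... + 2^(-m)) = 4 - 2 / 2^m.\<close>

lemma bump_transform_sincard_prod: "bump_transform (4 - 2 / 2 ^ m) (sincard_prod (Suc m))"
proof (induction m)
  case 0
  then show ?case using bump_transform_sincard_sq by (simp add: sincard_prod_def cong: if_cong)
next
  case (Suc m)
  let ?a = "1 / 2 ^ Suc m :: real"
  have "bump_transform (4 - 2 / 2 ^ m + ?a + ?a)
      (\<lambda>\<xi>. sincard (?a * \<xi>) * (sincard (?a * \<xi>) * sincard_prod (Suc m) \<xi>))"
    by (intro bump_transform_sincard_mult Suc.IH) auto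
  moreover have "(\<lambda>\<xi>. sincard (?a * \<xi>) * (sincard (?a * \<xi>) * sincard_prod (Suc m) \<xi>)) = sincard_prod (Suc (Suc m))"
    by (simp add: fun_eq_iff sincard_prod_Suc[of "Suc m"] power2_eq_square)
  moreover have "4 - 2 / 2 ^ m + ?a + ?a = 4 - 2 / 2 ^ Suc m" by simp
  ultimately show ?case by (simp only:)
qed

text \<open>Each factor with index k \<ge> 1 absorbs \<xi>^2 at the price 4^k, because |sin| \<le>
  1. The factor with index 0 is kept, as it supplies integrability.\<close>

lemma sincard_prod_decay:
  "\<exists>C. \<forall>\<xi>. \<xi> ^ (2 * m) * sincard_prod (Suc m) \<xi> \<le> C * (sincard \<xi>)\<^sup>2"
proof (induction m)
  case 0
  then show ?case by (intro exI[of _ 1]) (simp add: sincard_prod_def)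
next
  case (Suc m)
  then obtain C where C: "\<And>\<xi>. \<xi> ^ (2 * m) * sincard_prod (Suc m) \<xi> \<le> C * (sincard \<xi>)\<^sup>2" by blast
  have "\<xi> ^ (2 * Suc m) * sincard_prod (Suc (Suc m)) \<xi> \<le> (4 ^ Suc m * C) * (sincard \<xi>)\<^sup>2" for \<xi>
  proof -
    have "\<xi>\<^sup>2 * (sincard (\<xi> / 2 ^ Suc m))\<^sup>2 \<le> 4 ^ Suc m"
    proof (cases "\<xi> = 0")
      case False
      then have "\<xi>\<^sup>2 * (sincard (\<xi> / 2 ^ Suc m))\<^sup>2 = (2 ^ Suc m)\<^sup>2 * (sin (\<xi> / 2 ^ Suc m))\<^sup>2"
        by (simp add: sincard_def power_divide power_mult_distrib)
      also have "\<dots> \<le> (2 ^ Suc m)\<^sup>2 * 1"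
        by (intro mult_left_mono) (auto simp: abs_square_le_1)
      also have "\<dots> = (4::real) ^ Suc m"
        by (simp add: power2_eq_square flip: power_mult_distrib)
      finally show ?thesis .
    qed simp
    then have "(\<xi>\<^sup>2 * (sincard (\<xi> / 2 ^ Suc m))\<^sup>2) * (\<xi> ^ (2 * m) * sincard_prod (Suc m) \<xi>)
        \<le> 4 ^ Suc m * (C * (sincard \<xi>)\<^sup>2)"
      by (intro mult_mono C) (auto simp: sincard_prod_nonneg)
    then show ?thesis by (simp add: sincard_prod_Suc[of "Suc m"] power2_eq_square mult_ac)
  qed
  then show ?case by blast
qed

text \<open>The Weierstrass product inequality.\<close>

lemma one_minus_sum_le_prod:
  fixes a :: "nat \<Rightarrow> real"
  assumes "\<And>k. 0 \<le> a k \<and> a k \<le> 1"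
  shows "1 - (\<Sum>k<m. a k) \<le> (\<Prod>k<m. 1 - a k)"
proof (induction m)
  case (Suc m)
  have "(\<Prod>k<m. 1 - a k) \<le> 1" using assms by (intro prod_le_1) auto
  then have "(\<Prod>k<m. 1 - a k) * a m \<le> a m" using assms by (intro mult_left_le_one_le prod_nonneg) auto
  with Suc show ?case by (simp add: algebra_simps)
qed simp

text \<open>The deviations \<xi>^2 / 4^k of the factors from 1 sum to at most (1/4)(4/3) = 1/3. The
  bound is uniform in \<open>m\<close> and so passes to the infinite product.\<close>

lemma sincard_prod_ge:
  assumes "\<bar>\<xi>\<bar> \<le> 1/2"
  shows "1/2 \<le> sincard_prod m \<xi>"
proof -
  have x: "\<xi>\<^sup>2 \<le> 1/4"
    using power_mono[of "\<bar>\<xi>\<bar>" "1/2" 2] assms by (simp add: power_divide)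
  have small: "(\<xi> / 2 ^ k)\<^sup>2 = \<xi>\<^sup>2 * (1/4) ^ k" for k
    by (simp add: power_divide power2_eq_square flip: power_mult_distrib)
  have le1: "(\<xi> / 2 ^ k)\<^sup>2 \<le> 1" for k
  proof -
    have "\<xi>\<^sup>2 * (1/4) ^ k \<le> 1/4 * 1" using x by (intro mult_mono power_le_one) auto
    then show ?thesis by (simp only: small)
  qed
  have "(\<Sum>k<m. (\<xi> / 2 ^ k)\<^sup>2) = \<xi>\<^sup>2 * (\<Sum>k<m. (1/4) ^ k)"
    by (simp only: small sum_distrib_left)
  also have "(\<Sum>k<m. (1/4::real) ^ k) \<le> 4/3" by (simp add: sum_gp_strict)
  then have "\<xi>\<^sup>2 * (\<Sum>k<m. (1/4) ^ k) \<le> 1/4 * (4/3)" using x by (intro mult_mono) (auto intro: sum_nonneg)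
  finally have "(\<Sum>k<m. (\<xi> / 2 ^ k)\<^sup>2) \<le> 1/2" by simp
  then have "1/2 \<le> 1 - (\<Sum>k<m. (\<xi> / 2 ^ k)\<^sup>2)" by simp
  also have "\<dots> \<le> (\<Prod>k<m. 1 - (\<xi> / 2 ^ k)\<^sup>2)"
    by (rule one_minus_sum_le_prod) (simp add: le1)
  also have "\<dots> \<le> sincard_prod m \<xi>"
    unfolding sincard_prod_def by (intro prod_mono conjI sincard_sq_ge) (use le1 in simp)
  finally show ?thesis .
qed

text \<open>Up to a dilation and a constant, this is the square of the Fourier transform of
  Rvachev's up function.\<close>

definition sincard_inf_prod :: "real \<Rightarrow> real" where
  "sincard_inf_prod \<xi> = lim (\<lambda>m. sincard_prod m \<xi>)"

lemma sincard_prod_tendsto: "(\<lambda>m. sincard_prod m \<xi>) \<longlonglongrightarrow> sincard_inf_prod \<xi>"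
proof -
  have "convergent (\<lambda>m. sincard_prod m \<xi>)"
    using decseq_convergent[OF decseq_sincard_prod, of 0 \<xi>] sincard_prod_nonneg by (metis convergent_def)
  then show ?thesis unfolding sincard_inf_prod_def by (simp add: convergent_LIMSEQ_iff)
qed

lemma sincard_inf_prod_measurable [measurable]: "sincard_inf_prod \<in> borel_measurable borel"
  using sincard_prod_tendsto by (rule borel_measurable_LIMSEQ_real) measurable

lemma sincard_inf_prod_le: "sincard_inf_prod \<xi> \<le> sincard_prod m \<xi>"
  by (rule decseq_ge[OF decseq_sincard_prod sincard_prod_tendsto])

lemma sincard_inf_prod_nonneg: "0 \<le> sincard_inf_prod \<xi>"
  by (rule LIMSEQ_le_const[OF sincard_prod_tendsto]) (auto simp: sincard_prod_nonneg)

lemma sincard_inf_prod_le_1: "sincard_inf_prod \<xi> \<le> 1"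
  using sincard_inf_prod_le[of \<xi> 0] by (simp add: sincard_prod_def)

lemma sincard_inf_prod_ge: "\<bar>\<xi>\<bar> \<le> 1/2 \<Longrightarrow> 1/2 \<le> sincard_inf_prod \<xi>"
  by (rule LIMSEQ_le_const[OF sincard_prod_tendsto]) (intro exI[of _ 0] allI impI sincard_prod_ge)

lemma sincard_inf_prod_minus [simp]: "sincard_inf_prod (- \<xi>) = sincard_inf_prod \<xi>"
  by (simp add: sincard_inf_prod_def)

text \<open>The bound |\<xi>|^j \<le> 1 + \<xi>^(2j) reduces everything to even powers, where the
  decay of a finite product leaves a multiple of the integrable sinc^2. Finiteness of all moments is
  what makes the bump smooth.\<close>

lemma integrable_power_sincard_inf_prod: "integrable lborel (\<lambda>\<xi>. \<xi> ^ j * sincard_inf_prod \<xi>)"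
proof -
  obtain C where C: "\<And>\<xi>. \<xi> ^ (2 * j) * sincard_prod (Suc j) \<xi> \<le> C * (sincard \<xi>)\<^sup>2"
    using sincard_prod_decay by blast
  show ?thesis
  proof (rule Bochner_Integration.integrable_bound)
    show "integrable lborel (\<lambda>\<xi>. (1 + C) * (sincard \<xi>)\<^sup>2)"
      by (intro integrable_mult_right integrable_sincard_sq)
    have "\<bar>\<xi> ^ j * sincard_inf_prod \<xi>\<bar> \<le> (1 + C) * (sincard \<xi>)\<^sup>2" for \<xi>
    proof -
      have "\<bar>\<xi>\<bar> ^ j \<le> 1 + (\<bar>\<xi>\<bar> ^ j)\<^sup>2"
        using zero_le_power2[of "\<bar>\<xi>\<bar> ^ j - 1/2"] by (simp add: power2_eq_square algebra_simps)
      also have "(\<bar>\<xi>\<bar> ^ j)\<^sup>2 = \<xi> ^ (2 * j)"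
        by (simp add: power_mult mult.commute power_even_abs flip: power_mult)
      finally have "\<bar>\<xi>\<bar> ^ j * sincard_inf_prod \<xi> \<le> (1 + \<xi> ^ (2 * j)) * sincard_inf_prod \<xi>"
        by (intro mult_right_mono sincard_inf_prod_nonneg)
      also have "\<dots> = sincard_inf_prod \<xi> + \<xi> ^ (2 * j) * sincard_inf_prod \<xi>"
        by (simp add: algebra_simps)
      also have "\<dots> \<le> sincard_prod (Suc 0) \<xi> + \<xi> ^ (2 * j) * sincard_prod (Suc j) \<xi>"
        by (intro add_mono mult_left_mono sincard_inf_prod_le) (simp add: power_mult)
      also have "\<dots> \<le> (1 + C) * (sincard \<xi>)\<^sup>2"
        using C[of \<xi>] by (simp add: sincard_prod_def algebra_simps)
      finally show ?thesis by (simp add: abs_mult power_abs sincard_inf_prod_nonneg)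
    qed
    then show "AE \<xi> in lborel. norm (\<xi> ^ j * sincard_inf_prod \<xi>) \<le> norm ((1 + C) * (sincard \<xi>)\<^sup>2)"
      by (intro AE_I2) (use order_trans[OF _ abs_ge_self] in auto)
  qed measurable
qed

lemma integrable_sincard_inf_prod: "integrable lborel sincard_inf_prod"
  using integrable_power_sincard_inf_prod[of 0] by simp

text \<open>The factor sinc^2 with index 0 majorises every nonempty product. The index
  \<open>Suc m\<close> avoids the empty product 1, which is not integrable.\<close>

lemma cos_transform_sincard_inf_prod_lim:
  "(\<lambda>m. cos_transform (sincard_prod (Suc m)) x) \<longlonglongrightarrow> cos_transform sincard_inf_prod x"
  unfolding cos_transform_def
proof (rule integral_dominated_convergence)
  show "integrable lborel (\<lambda>\<xi>. (sincard \<xi>)\<^sup>2)" by (rule integrable_sincard_sq)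
  show "AE \<xi> in lborel. (\<lambda>m. cos (x * \<xi>) * sincard_prod (Suc m) \<xi>) \<longlonglongrightarrow> cos (x * \<xi>) * sincard_inf_prod \<xi>"
    by (intro AE_I2 tendsto_intros LIMSEQ_Suc sincard_prod_tendsto)
  have "norm (cos (x * \<xi>) * sincard_prod (Suc m) \<xi>) \<le> (sincard \<xi>)\<^sup>2" for m \<xi>
  proof -
    have "norm (cos (x * \<xi>) * sincard_prod (Suc m) \<xi>) \<le> sincard_prod (Suc m) \<xi>"
      by (auto simp: abs_mult sincard_prod_nonneg intro!: mult_left_le_one_le)
    also have "\<dots> \<le> sincard_prod (Suc 0) \<xi>"
      by (rule decseqD[OF decseq_sincard_prod]) simp
    finally show ?thesis by (simp add: sincard_prod_def)
  qed
  then show "AE \<xi> in lborel. norm (cos (x * \<xi>) * sincard_prod (Suc m) \<xi>) \<le> (sincard \<xi>)\<^sup>2" for m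
    by simp
qed measurable

text \<open>Nonnegativity and vanishing at a point are preserved by limits, and 4 exceeds all the
  radii 4 - 2 / 2^m.\<close>

lemma bump_transform_sincard_inf_prod: "bump_transform 4 sincard_inf_prod"
  unfolding bump_transform_def
proof (intro conjI allI impI)
  show "integrable lborel sincard_inf_prod" by (rule integrable_sincard_inf_prod)
  show "0 \<le> cos_transform sincard_inf_prod x" for x
    using bump_transform_sincard_prod
    by (intro LIMSEQ_le_const[OF cos_transform_sincard_inf_prod_lim]) (auto simp: bump_transform_def)
  show "cos_transform sincard_inf_prod x = 0" if "4 \<le> \<bar>x\<bar>" for x
  proof -
    have "cos_transform (sincard_prod (Suc m)) x = 0" for m
    proof -
      have "4 - 2 / 2 ^ m \<le> \<bar>x\<bar>" using that by (rule order_trans[rotated]) simp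
      then show ?thesis using bump_transform_sincard_prod[of m] by (auto simp: bump_transform_def)
    qed
    then show ?thesis
      using LIMSEQ_unique[OF cos_transform_sincard_inf_prod_lim[of x]] by simp
  qed
qed

section \<open>Differentiation of cosine integrals, and the normalised bump\<close>

lemma abs_cos_taylor: "\<bar>cos (a + h) - cos a + h * sin a\<bar> \<le> h\<^sup>2" for a h :: real
proof -
  have "\<bar>cos h - 1\<bar> \<le> h\<^sup>2 / 2" using cos_ge[of h] by simp
  moreover have "\<bar>sin h - h\<bar> \<le> h\<^sup>2 / 2"
  proof -
    have "\<bar>sin h - (\<Sum>k<Suc (Suc 0). sin_coeff k * h ^ k)\<bar> \<le> inverse (fact (Suc (Suc 0))) * \<bar>h\<bar> ^ Suc (Suc 0)"
      by (rule Maclaurin_sin_bound)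
    then show ?thesis
      by (simp add: sin_coeff_def power2_eq_square)
  qed
  moreover have "cos (a + h) - cos a + h * sin a = cos a * (cos h - 1) - sin a * (sin h - h)"
    by (simp add: cos_add algebra_simps)
  moreover have "\<bar>cos a * (cos h - 1)\<bar> \<le> \<bar>cos h - 1\<bar>" "\<bar>sin a * (sin h - h)\<bar> \<le> \<bar>sin h - h\<bar>"
    by (auto simp: abs_mult intro!: mult_left_le_one_le)
  ultimately show ?thesis by linarith
qed

text \<open>The Taylor error of the cosine is at most (h \<xi>)^2, so the second moment bounds the
  error of the difference quotient by M |h|. Writing -sin as a cosine with phase advanced by pi/2
  gives the derivative the same shape as the integral, so the lemma can be iterated.\<close>

lemma has_real_derivative_cos_integral:
  fixes F :: "real \<Rightarrow> real"
  assumes F: "integrable lborel F" "integrable lborel (\<lambda>\<xi>. \<xi> * F \<xi>)" "integrable lborel (\<lambda>\<xi>. \<xi>\<^sup>2 * F \<xi>)"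
  shows "((\<lambda>x. \<integral>\<xi>. cos (x * \<xi> + c) * F \<xi> \<partial>lborel) has_real_derivative
    (\<integral>\<xi>. cos (x * \<xi> + (c + pi / 2)) * (\<xi> * F \<xi>) \<partial>lborel)) (at x)"
proof -
  define I where "I = (\<lambda>x. \<integral>\<xi>. cos (x * \<xi> + c) * F \<xi> \<partial>lborel)"
  define D where "D = (\<integral>\<xi>. cos (x * \<xi> + (c + pi / 2)) * (\<xi> * F \<xi>) \<partial>lborel)"
  define M where "M = (\<integral>\<xi>. \<bar>\<xi>\<^sup>2 * F \<xi>\<bar> \<partial>lborel)"
  have alg: "A * f - B * f - k * (- S * (y * f)) = (A - B + (k * y) * S) * f" for A B S f k y :: real
    by (simp add: algebra_simps)
  have bound: "\<bar>I (x + h) - I x - h * D\<bar> \<le> M * h\<^sup>2" for h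
  proof -
    let ?f = "\<lambda>\<xi>. cos ((x + h) * \<xi> + c) * F \<xi> - cos (x * \<xi> + c) * F \<xi> - h * (cos (x * \<xi> + (c + pi / 2)) * (\<xi> * F \<xi>))"
    have "\<bar>I (x + h) - I x - h * D\<bar> = \<bar>\<integral>\<xi>. ?f \<xi> \<partial>lborel\<bar>"
      unfolding I_def D_def
      by (simp add: integrable_cos_mult F)
    also have "\<dots> \<le> (\<integral>\<xi>. h\<^sup>2 * \<bar>\<xi>\<^sup>2 * F \<xi>\<bar> \<partial>lborel)"
    proof (rule order_trans[OF integral_abs_bound], rule integral_mono)
      show "integrable lborel (\<lambda>\<xi>. \<bar>?f \<xi>\<bar>)"
        by (intro integrable_abs Bochner_Integration.integrable_diff integrable_cos_mult integrable_mult_right F)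
      show "integrable lborel (\<lambda>\<xi>. h\<^sup>2 * \<bar>\<xi>\<^sup>2 * F \<xi>\<bar>)"
        by (intro integrable_mult_right integrable_abs F)
      show "\<bar>?f \<xi>\<bar> \<le> h\<^sup>2 * \<bar>\<xi>\<^sup>2 * F \<xi>\<bar>" for \<xi>
      proof -
        have 1: "cos (x * \<xi> + (c + pi / 2)) = - sin (x * \<xi> + c)"
          using cos_add[of "x * \<xi> + c" "pi/2"] by (simp only: add.assoc cos_pi_half sin_pi_half mult_zero_right mult_1_right diff_0)
        have 2: "(x + h) * \<xi> + c = (x * \<xi> + c) + h * \<xi>" by (simp add: algebra_simps)
        have "\<bar>?f \<xi>\<bar> = \<bar>(cos ((x * \<xi> + c) + h * \<xi>) - cos (x * \<xi> + c) + (h * \<xi>) * sin (x * \<xi> + c)) * F \<xi>\<bar>"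
          unfolding 1 2 by (simp only: alg)
        also have "\<dots> \<le> (h * \<xi>)\<^sup>2 * \<bar>F \<xi>\<bar>"
          unfolding abs_mult by (rule mult_right_mono[OF abs_cos_taylor abs_ge_zero])
        also have "\<dots> = h\<^sup>2 * \<bar>\<xi>\<^sup>2 * F \<xi>\<bar>"
          by (simp only: abs_mult power_mult_distrib abs_power2 mult.assoc)
        finally show ?thesis .
      qed
    qed
    also have "\<dots> = M * h\<^sup>2" by (simp add: M_def)
    finally show ?thesis .
  qed
  have "(\<lambda>h. (I (x + h) - I x) / h - D) \<midarrow>0\<rightarrow> 0"
  proof (rule Lim_null_comparison)
    show "\<forall>\<^sub>F h in at 0. norm ((I (x + h) - I x) / h - D) \<le> M * \<bar>h\<bar>"
    proof (rule eventually_at_filter[THEN iffD2], intro always_eventually allI impI)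
      fix h :: real assume "h \<noteq> 0"
      then have "norm ((I (x + h) - I x) / h - D) = norm ((I (x + h) - I x - h * D) / h)" by (simp add: diff_divide_distrib)
      also have "\<dots> \<le> M * h\<^sup>2 / \<bar>h\<bar>"
        using bound[of h] by (simp add: divide_right_mono)
      also have "\<dots> = M * \<bar>h\<bar>" using \<open>h \<noteq> 0\<close> by (simp add: power2_eq_square abs_if)
      finally show "norm ((I (x + h) - I x) / h - D) \<le> M * \<bar>h\<bar>" .
    qed
    show "(\<lambda>h. M * \<bar>h\<bar>) \<midarrow>0\<rightarrow> 0" by (auto intro!: tendsto_eq_intros)
  qed
  then have "(I has_real_derivative D) (at x)"
    unfolding DERIV_def by (rule LIM_zero_cancel)
  then show ?thesis by (simp add: I_def D_def)
qed

section \<open>Powers and dilations of Fourier integrals of nonnegative densities\<close>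

definition fourier_char :: "real \<Rightarrow> complex" where
  "fourier_char t = exp (- (\<i> * of_real t))"

lemma fourier_char_eq: "fourier_char t = Complex (cos t) (- sin t)"
  by (simp add: fourier_char_def exp_eq_polar complex_eq_iff Re_exp Im_exp)

lemma norm_fourier_char [simp]: "norm (fourier_char t) = 1"
  by (simp add: fourier_char_def)

lemma fourier_char_measurable [measurable]: "fourier_char \<in> borel_measurable borel"
  unfolding fourier_char_def by (intro borel_measurable_continuous_onI continuous_intros)

lemma fourier_char_add: "fourier_char (s + t) = fourier_char s * fourier_char t"
  by (simp add: fourier_char_def exp_add[symmetric] algebra_simps)

text \<open>Boundedness of \<open>g\<close>, together with integrability, puts it in L^2, where it
  can be paired with the transform of the data, and makes convolutions exist at every point. The
  lower bound near 0 selects the low frequencies in that pairing.\<close>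

definition fourier_pos :: "(real \<Rightarrow> real) \<Rightarrow> (real \<Rightarrow> real) \<Rightarrow> bool" where
  "fourier_pos h g \<longleftrightarrow> integrable lborel g \<and> (\<forall>\<xi>. 0 \<le> g \<xi>) \<and> (\<exists>M. \<forall>\<xi>. g \<xi> \<le> M) \<and>
     (\<exists>b>0. \<exists>c>0. \<forall>\<xi>. \<bar>\<xi>\<bar> \<le> b \<longrightarrow> c \<le> g \<xi>) \<and>
     (\<forall>x. complex_of_real (h x) = (\<integral>\<xi>. fourier_char (x * \<xi>) * of_real (g \<xi>) \<partial>lborel))"

lemma fourier_integral_even:
  assumes G: "integrable lborel G" and even: "\<And>\<xi>. G (- \<xi>) = G \<xi>"
  shows "(\<integral>\<xi>. fourier_char (x * \<xi>) * of_real (G \<xi>) \<partial>lborel) = complex_of_real (cos_transform G x)"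
proof -
  have int: "integrable lborel (\<lambda>\<xi>. cos (x * \<xi>) * G \<xi>)" "integrable lborel (\<lambda>\<xi>. sin (x * \<xi>) * G \<xi>)"
    using integrable_cos_mult[OF G, of x 0] integrable_cos_mult[OF G, of x "- (pi / 2)"]
    by (simp_all add: cos_diff)
  have "(\<integral>\<xi>. sin (x * \<xi>) * G \<xi> \<partial>lborel) = - (\<integral>\<xi>. sin (x * \<xi>) * G \<xi> \<partial>lborel)"
    using lborel_integral_real_affine[of "-1" "\<lambda>\<xi>. sin (x * \<xi>) * G \<xi>" 0] by (simp add: even)
  then have sin0: "(\<integral>\<xi>. sin (x * \<xi>) * G \<xi> \<partial>lborel) = 0" by simp
  have "(\<integral>\<xi>. fourier_char (x * \<xi>) * of_real (G \<xi>) \<partial>lborel) =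
    (\<integral>\<xi>. complex_of_real (cos (x * \<xi>) * G \<xi>) - \<i> * complex_of_real (sin (x * \<xi>) * G \<xi>) \<partial>lborel)"
    by (intro Bochner_Integration.integral_cong) (auto simp: fourier_char_eq complex_eq_iff)
  also have "\<dots> = complex_of_real (\<integral>\<xi>. cos (x * \<xi>) * G \<xi> \<partial>lborel) - \<i> * complex_of_real (\<integral>\<xi>. sin (x * \<xi>) * G \<xi> \<partial>lborel)"
    using int by (subst Bochner_Integration.integral_diff)
      (auto simp del: of_real_mult intro!: integrable_mult_right integrable_of_real)
  finally show ?thesis by (simp add: sin0 cos_transform_def)
qed

lemma smooth_bump_exists:
  obtains H :: "nat \<Rightarrow> real \<Rightarrow> real" and g where
    "\<And>j x. (H j has_real_derivative H (Suc j) x) (at x)"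
    "\<And>x. 0 \<le> H 0 x" "\<And>x. H 0 x \<le> 1" "\<And>x. 4 \<le> \<bar>x\<bar> \<Longrightarrow> H 0 x = 0" "H 0 0 = 1" "H 1 0 = 0"
    "fourier_pos (H 0) g"
proof -
  define Z where "Z = (\<integral>\<xi>. sincard_inf_prod \<xi> \<partial>lborel)"
  \<comment> \<open>The density is at least 1/2 on an interval of length 1, so \<open>Z\<close> is
    positive; dividing by it normalises \<open>H 0 0 = 1\<close>.\<close>
  have "(\<integral>\<xi>. indicator {-1/2..1/2::real} \<xi> * (1/2) \<partial>lborel) \<le> Z"
    unfolding Z_def
  proof (rule integral_mono[OF _ integrable_sincard_inf_prod])
    show "integrable lborel (\<lambda>\<xi>. indicator {- 1 / 2..1 / 2::real} \<xi> * (1 / 2 :: real))"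
      by (intro integrable_mult_left integrable_real_indicator) (auto simp: emeasure_lborel_Icc_eq)
    show "indicator {- 1 / 2..1 / 2::real} \<xi> * (1 / 2 :: real) \<le> sincard_inf_prod \<xi>" for \<xi>
      using sincard_inf_prod_ge[of \<xi>] sincard_inf_prod_nonneg[of \<xi>] by (auto split: split_indicator)
  qed
  then have Z: "0 < Z" by simp
  \<comment> \<open>Since cos(. + j pi/2) is the j-th derivative of cos, \<open>H j\<close> is the
    j-th derivative of \<open>H 0\<close>.\<close>
  define H where "H = (\<lambda>j x. (\<integral>\<xi>. cos (x * \<xi> + real j * (pi / 2)) * (\<xi> ^ j * sincard_inf_prod \<xi>) \<partial>lborel) / Z)"
  define g where "g = (\<lambda>\<xi>. sincard_inf_prod \<xi> / Z)"
  have H0: "H 0 x = cos_transform sincard_inf_prod x / Z" for x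
    by (simp add: H_def cos_transform_def)
  have deriv: "(H j has_real_derivative H (Suc j) x) (at x)" for j x
  proof -
    have "integrable lborel (\<lambda>\<xi>. \<xi> * (\<xi> ^ j * sincard_inf_prod \<xi>))"
      "integrable lborel (\<lambda>\<xi>. \<xi>\<^sup>2 * (\<xi> ^ j * sincard_inf_prod \<xi>))"
      using integrable_power_sincard_inf_prod[of "Suc j"] integrable_power_sincard_inf_prod[of "Suc (Suc j)"]
      by (simp_all add: power2_eq_square mult_ac)
    from has_real_derivative_cos_integral[OF integrable_power_sincard_inf_prod this, of "real j * (pi / 2)" x]
    have "((\<lambda>x. \<integral>\<xi>. cos (x * \<xi> + real j * (pi / 2)) * (\<xi> ^ j * sincard_inf_prod \<xi>) \<partial>lborel) has_real_derivative
        (\<integral>\<xi>. cos (x * \<xi> + real (Suc j) * (pi / 2)) * (\<xi> ^ Suc j * sincard_inf_prod \<xi>) \<partial>lborel)) (at x)"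
      by (simp add: algebra_simps add_divide_distrib)
    then show ?thesis unfolding H_def by (rule DERIV_cdivide)
  qed
  have nonneg: "0 \<le> H 0 x" for x
    using bump_transform_sincard_inf_prod Z by (simp add: H0 bump_transform_def)
  have supp: "H 0 x = 0" if "4 \<le> \<bar>x\<bar>" for x
    using bump_transform_sincard_inf_prod that by (simp add: H0 bump_transform_def)
  have "cos_transform sincard_inf_prod x \<le> Z" for x
    unfolding cos_transform_def Z_def
    using integrable_cos_mult[OF integrable_sincard_inf_prod, of x 0]
      mult_right_mono[OF cos_le_one sincard_inf_prod_nonneg]
    by (intro integral_mono integrable_sincard_inf_prod) auto
  then have le1: "H 0 x \<le> 1" for x using Z by (simp add: H0)
  have one: "H 0 0 = 1" using Z by (simp add: H0 cos_transform_def Z_def)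
  \<comment> \<open>At x = 0 the integrand carries the constant factor cos(pi/2) = 0.\<close>
  have flat: "H 1 0 = 0" by (simp add: H_def)
  have "fourier_pos (H 0) g"
    unfolding fourier_pos_def
  proof (intro conjI allI)
    show int: "integrable lborel g" unfolding g_def by (intro integrable_divide_zero integrable_divide integrable_sincard_inf_prod)
    show "0 \<le> g \<xi>" for \<xi> using Z by (simp add: g_def sincard_inf_prod_nonneg)
    show "\<exists>M. \<forall>\<xi>. g \<xi> \<le> M"
      using Z by (intro exI[of _ "1 / Z"]) (auto simp: g_def sincard_inf_prod_le_1 divide_right_mono)
    show "\<exists>b>0. \<exists>c>0. \<forall>\<xi>. \<bar>\<xi>\<bar> \<le> b \<longrightarrow> c \<le> g \<xi>"
      using Z sincard_inf_prod_ge
      by (intro exI[of _ "1/2"] conjI exI[of _ "1 / 2 / Z"]) (auto simp: g_def divide_right_mono simp del: divide_divide_eq_left)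
    show "complex_of_real (H 0 x) = (\<integral>\<xi>. fourier_char (x * \<xi>) * of_real (g \<xi>) \<partial>lborel)" for x
      by (subst fourier_integral_even[OF int]) (auto simp: g_def H0 cos_transform_def)
  qed
  from that[OF deriv nonneg le1 supp one flat this] show thesis by blast
qed

lemma fourier_pos_scale:
  assumes "fourier_pos h g" and "0 < l"
  shows "fourier_pos (\<lambda>x. h (x / l)) (\<lambda>\<xi>. l * g (l * \<xi>))"
  unfolding fourier_pos_def
proof (intro conjI allI)
  have g: "integrable lborel g" using assms by (simp add: fourier_pos_def)
  show "integrable lborel (\<lambda>\<xi>. l * g (l * \<xi>))"
    using lborel_integrable_real_affine[OF g, of l 0] assms by simp
  show "0 \<le> l * g (l * \<xi>)" for \<xi> using assms by (simp add: fourier_pos_def)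
  obtain M where "\<And>\<xi>. g \<xi> \<le> M" using assms by (auto simp: fourier_pos_def)
  then show "\<exists>M. \<forall>\<xi>. l * g (l * \<xi>) \<le> M" using assms by (intro exI[of _ "l * M"]) auto
  obtain b c where bc: "0 < b" "0 < c" "\<And>\<xi>. \<bar>\<xi>\<bar> \<le> b \<Longrightarrow> c \<le> g \<xi>"
    using assms by (auto simp: fourier_pos_def)
  show "\<exists>b>0. \<exists>c>0. \<forall>\<xi>. \<bar>\<xi>\<bar> \<le> b \<longrightarrow> c \<le> l * g (l * \<xi>)"
    using bc assms(2)
    by (intro exI[of _ "b / l"] conjI exI[of _ "l * c"]) (auto simp: abs_mult field_simps)
  show "complex_of_real (h (x / l)) = (\<integral>\<xi>. fourier_char (x * \<xi>) * of_real (l * g (l * \<xi>)) \<partial>lborel)" for x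
  proof -
    have "complex_of_real (h (x / l)) = (\<integral>\<xi>. fourier_char (x / l * \<xi>) * of_real (g \<xi>) \<partial>lborel)"
      using assms by (simp add: fourier_pos_def)
    also have "\<dots> = \<bar>l\<bar> *\<^sub>R (\<integral>\<xi>. fourier_char (x / l * (0 + l * \<xi>)) * of_real (g (0 + l * \<xi>)) \<partial>lborel)"
      using assms by (intro lborel_integral_real_affine) auto
    also have "\<dots> = of_real l * (\<integral>\<xi>. fourier_char (x * \<xi>) * of_real (g (l * \<xi>)) \<partial>lborel)"
      using assms by (simp add: scaleR_conv_of_real)
    also have "\<dots> = (\<integral>\<xi>. of_real l * (fourier_char (x * \<xi>) * of_real (g (l * \<xi>))) \<partial>lborel)"
      by (rule integral_mult_right_zero[symmetric])
    finally show ?thesis by (simp add: mult_ac)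
  qed
qed

text \<open>A product of Fourier integrals has the convolution of the densities as its density, and
  convolution preserves nonnegativity, boundedness and positivity near 0.\<close>

lemma fourier_pos_mult:
  assumes "fourier_pos h1 g1" and "fourier_pos h2 g2"
  shows "fourier_pos (\<lambda>x. h1 x * h2 x) (\<lambda>\<tau>. \<integral>\<zeta>. g1 (\<tau> - \<zeta>) * g2 \<zeta> \<partial>lborel)"
proof -
  have g: "integrable lborel g1" "integrable lborel g2" "\<And>\<xi>. 0 \<le> g1 \<xi>" "\<And>\<xi>. 0 \<le> g2 \<xi>"
    and h: "\<And>x. complex_of_real (h1 x) = (\<integral>\<xi>. fourier_char (x * \<xi>) * of_real (g1 \<xi>) \<partial>lborel)"
      "\<And>x. complex_of_real (h2 x) = (\<integral>\<xi>. fourier_char (x * \<xi>) * of_real (g2 \<xi>) \<partial>lborel)"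
    using assms by (auto simp: fourier_pos_def)
  obtain M where M: "\<And>\<xi>. g1 \<xi> \<le> M" using assms(1) by (auto simp: fourier_pos_def)
  obtain b1 c1 where bc1: "0 < b1" "0 < c1" "\<And>\<xi>. \<bar>\<xi>\<bar> \<le> b1 \<Longrightarrow> c1 \<le> g1 \<xi>"
    using assms(1) by (auto simp: fourier_pos_def)
  obtain b2 c2 where bc2: "0 < b2" "0 < c2" "\<And>\<xi>. \<bar>\<xi>\<bar> \<le> b2 \<Longrightarrow> c2 \<le> g2 \<xi>"
    using assms(2) by (auto simp: fourier_pos_def)
  have [measurable]: "g1 \<in> borel_measurable borel" "g2 \<in> borel_measurable borel"
    using borel_measurable_integrable[OF g(1)] borel_measurable_integrable[OF g(2)] by simp_all
  have shift: "(\<integral>\<tau>. f (\<tau> - \<zeta>) \<partial>lborel) = (\<integral>\<tau>. f \<tau> \<partial>lborel)" for f :: "real \<Rightarrow> 'b::{banach, second_countable_topology}" and \<zeta>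
    using lborel_integral_real_affine[of 1 f "- \<zeta>"] by simp
  have shift_int: "integrable lborel (\<lambda>\<tau>. g1 (\<tau> - \<zeta>))" for \<zeta>
    using lborel_integrable_real_affine[OF g(1), of 1 "- \<zeta>"] by simp
  have int: "integrable (lborel \<Otimes>\<^sub>M lborel) (\<lambda>(\<zeta>, \<tau>). g1 (\<tau> - \<zeta>) * g2 \<zeta>)"
  proof (rule lborel_pair.Fubini_integrable)
    have "(\<integral>\<tau>. norm (g1 (\<tau> - \<zeta>) * g2 \<zeta>) \<partial>lborel) = (\<integral>\<tau>. g1 \<tau> \<partial>lborel) * g2 \<zeta>" for \<zeta>
      using shift[of g1 \<zeta>] by (simp add: g abs_mult)
    then show "integrable lborel (\<lambda>\<zeta>. \<integral>\<tau>. norm (case (\<zeta>, \<tau>) of (\<zeta>, \<tau>) \<Rightarrow> g1 (\<tau> - \<zeta>) * g2 \<zeta>) \<partial>lborel)"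
      using g(2) by simp
    show "AE \<zeta> in lborel. integrable lborel (\<lambda>\<tau>. case (\<zeta>, \<tau>) of (\<zeta>, \<tau>) \<Rightarrow> g1 (\<tau> - \<zeta>) * g2 \<zeta>)"
      using shift_int by simp
  qed measurable
  \<comment> \<open>Fubini alone gives this for almost every \<tau>; boundedness of
    \<open>g1\<close> gives it for all, as the pointwise bounds require.\<close>
  have int': "integrable lborel (\<lambda>\<zeta>. g1 (\<tau> - \<zeta>) * g2 \<zeta>)" for \<tau>
  proof (rule Bochner_Integration.integrable_bound)
    show "integrable lborel (\<lambda>\<zeta>. M * g2 \<zeta>)" using g(2) by simp
    show "AE \<zeta> in lborel. norm (g1 (\<tau> - \<zeta>) * g2 \<zeta>) \<le> norm (M * g2 \<zeta>)"
      using order_trans[OF M abs_ge_self] by (auto simp: abs_mult g intro!: mult_right_mono)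
  qed measurable
  show ?thesis
    unfolding fourier_pos_def
  proof (intro conjI allI)
    show "integrable lborel (\<lambda>\<tau>. \<integral>\<zeta>. g1 (\<tau> - \<zeta>) * g2 \<zeta> \<partial>lborel)"
      using lborel_pair.integrable_snd[OF int] by simp
    show "0 \<le> (\<integral>\<zeta>. g1 (\<tau> - \<zeta>) * g2 \<zeta> \<partial>lborel)" for \<tau>
      by (intro Bochner_Integration.integral_nonneg mult_nonneg_nonneg g)
    have "(\<integral>\<zeta>. g1 (\<tau> - \<zeta>) * g2 \<zeta> \<partial>lborel) \<le> (\<integral>\<zeta>. M * g2 \<zeta> \<partial>lborel)" for \<tau>
      using g(2) by (intro integral_mono int' mult_right_mono M g) auto
    then show "\<exists>M. \<forall>\<tau>. (\<integral>\<zeta>. g1 (\<tau> - \<zeta>) * g2 \<zeta> \<partial>lborel) \<le> M" by blast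
    \<comment> \<open>If |\<tau>| and |\<zeta>| are at most \<open>b\<close>, then |\<tau> -
      \<zeta>| \<le> 2 b \<le> \<open>b1\<close> and |\<zeta>| \<le> \<open>b2\<close>, so both
      densities are in their good range on an interval of length 2 b.\<close>
    define b where "b = min b1 b2 / 2"
    have b: "0 < b" using bc1 bc2 by (simp add: b_def)
    have "2 * b * (c1 * c2) \<le> (\<integral>\<zeta>. g1 (\<tau> - \<zeta>) * g2 \<zeta> \<partial>lborel)" if "\<bar>\<tau>\<bar> \<le> b" for \<tau>
    proof -
      have "(\<integral>\<zeta>. indicator {-b..b} \<zeta> * (c1 * c2) \<partial>lborel) \<le> (\<integral>\<zeta>. g1 (\<tau> - \<zeta>) * g2 \<zeta> \<partial>lborel)"
      proof (rule integral_mono[OF _ int'])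
        show "integrable lborel (\<lambda>\<zeta>. indicator {-b..b} \<zeta> * (c1 * c2))"
          by (intro integrable_mult_left integrable_real_indicator) (auto simp: emeasure_lborel_Icc_eq)
        show "indicator {-b..b} \<zeta> * (c1 * c2) \<le> g1 (\<tau> - \<zeta>) * g2 \<zeta>" for \<zeta>
        proof (cases "\<zeta> \<in> {-b..b}")
          case True
          then have "\<bar>\<tau> - \<zeta>\<bar> \<le> b1" "\<bar>\<zeta>\<bar> \<le> b2" using that bc1(1) bc2(1) unfolding b_def by (auto simp: min_def abs_le_iff split: if_splits)
          then have "c1 * c2 \<le> g1 (\<tau> - \<zeta>) * g2 \<zeta>"
            using bc1 bc2 g by (intro mult_mono) auto
          then show ?thesis using True by simp
        qed (simp add: g)
      qed
      then show ?thesis using b by simp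
    qed
    then show "\<exists>b>0. \<exists>c>0. \<forall>\<tau>. \<bar>\<tau>\<bar> \<le> b \<longrightarrow> c \<le> (\<integral>\<zeta>. g1 (\<tau> - \<zeta>) * g2 \<zeta> \<partial>lborel)"
      using b bc1 bc2 by (intro exI[of _ b] conjI exI[of _ "2 * b * (c1 * c2)"]) auto
    show "complex_of_real (h1 x * h2 x) =
      (\<integral>\<tau>. fourier_char (x * \<tau>) * of_real (\<integral>\<zeta>. g1 (\<tau> - \<zeta>) * g2 \<zeta> \<partial>lborel) \<partial>lborel)" for x
    proof -
      let ?F = "\<lambda>\<zeta> \<tau>. fourier_char (x * \<tau>) * complex_of_real (g1 (\<tau> - \<zeta>) * g2 \<zeta>)"
      have intF: "integrable (lborel \<Otimes>\<^sub>M lborel) (\<lambda>(\<zeta>, \<tau>). ?F \<zeta> \<tau>)"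
        by (rule Bochner_Integration.integrable_bound[OF int]) (auto simp: norm_mult)
      have "complex_of_real (h1 x * h2 x) =
          (\<integral>\<zeta>. complex_of_real (h1 x) * (fourier_char (x * \<zeta>) * of_real (g2 \<zeta>)) \<partial>lborel)"
        by (simp add: h(2))
      also have "\<dots> = (\<integral>\<zeta>. \<integral>\<tau>. ?F \<zeta> \<tau> \<partial>lborel \<partial>lborel)"
      proof (intro Bochner_Integration.integral_cong refl)
        fix \<zeta>
        have "complex_of_real (h1 x) * (fourier_char (x * \<zeta>) * of_real (g2 \<zeta>)) =
          (\<integral>\<tau>. fourier_char (x * (\<tau> - \<zeta>)) * of_real (g1 (\<tau> - \<zeta>)) \<partial>lborel) * (fourier_char (x * \<zeta>) * of_real (g2 \<zeta>))"
          by (simp add: h(1) shift[of "\<lambda>\<xi>. fourier_char (x * \<xi>) * complex_of_real (g1 \<xi>)" \<zeta>])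
        also have "\<dots> = (\<integral>\<tau>. fourier_char (x * (\<tau> - \<zeta>)) * of_real (g1 (\<tau> - \<zeta>)) * (fourier_char (x * \<zeta>) * of_real (g2 \<zeta>)) \<partial>lborel)"
          by (rule integral_mult_left_zero[symmetric])
        also have "\<dots> = (\<integral>\<tau>. ?F \<zeta> \<tau> \<partial>lborel)"
        proof (intro Bochner_Integration.integral_cong refl)
          fix \<tau>
          have "fourier_char (x * \<tau>) = fourier_char (x * (\<tau> - \<zeta>)) * fourier_char (x * \<zeta>)"
            by (simp flip: fourier_char_add add: algebra_simps)
          then show "fourier_char (x * (\<tau> - \<zeta>)) * of_real (g1 (\<tau> - \<zeta>)) * (fourier_char (x * \<zeta>) * of_real (g2 \<zeta>)) = ?F \<zeta> \<tau>"
            by simp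
        qed
        finally show "complex_of_real (h1 x) * (fourier_char (x * \<zeta>) * of_real (g2 \<zeta>)) = (\<integral>\<tau>. ?F \<zeta> \<tau> \<partial>lborel)" .
      qed
      also have "\<dots> = (\<integral>\<tau>. \<integral>\<zeta>. ?F \<zeta> \<tau> \<partial>lborel \<partial>lborel)"
        using lborel_pair.Fubini_integral[OF intF] by simp
      also have "\<dots> = (\<integral>\<tau>. fourier_char (x * \<tau>) * of_real (\<integral>\<zeta>. g1 (\<tau> - \<zeta>) * g2 \<zeta> \<partial>lborel) \<partial>lborel)"
        by (simp only: integral_mult_right_zero integral_complex_of_real)
      finally show ?thesis .
    qed
  qed
qed

text \<open>The exponent starts at 1 because the constant function 1 is not the Fourier integral of
  an integrable density.\<close>

lemma fourier_pos_power:
  assumes "fourier_pos h g"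
  shows "\<exists>G. fourier_pos (\<lambda>x. h x ^ Suc k) G"
proof (induction k)
  case 0
  then show ?case using assms by auto
next
  case (Suc k)
  then obtain G where "fourier_pos (\<lambda>x. h x ^ Suc k) G" by blast
  from fourier_pos_mult[OF assms this] show ?case by auto
qed

section \<open>Smooth functions and the scaled test functions\<close>

lemma dir_derivI: "(f has_derivative D) (at z) \<Longrightarrow> dir_deriv v f z = D v"
  unfolding dir_deriv_def by (simp add: frechet_derivative_at[symmetric])

lemma differentiable_has_derivative_dir_deriv:
  "f differentiable (at z) \<Longrightarrow> (f has_derivative (\<lambda>v. dir_deriv v f z)) (at z)"
  unfolding dir_deriv_def by (simp add: frechet_derivative_works)

lemma dir_deriv_scaleR:
  assumes "f differentiable (at z)"
  shows "dir_deriv (c *\<^sub>R v) f z = c * dir_deriv v f z"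
  using has_derivative_linear[OF differentiable_has_derivative_dir_deriv[OF assms]]
  using linear_scale[of "\<lambda>v. dir_deriv v f z" c v] by simp

lemma dir_deriv_mult:
  assumes "f differentiable (at z)" "g differentiable (at z)"
  shows "dir_deriv v (\<lambda>z. f z * g z) z = f z * dir_deriv v g z + dir_deriv v f z * g z"
  by (rule dir_derivI) (intro has_derivative_mult differentiable_has_derivative_dir_deriv assms)

lemma dir_deriv_cmult:
  assumes "f differentiable (at z)"
  shows "dir_deriv v (\<lambda>z. c * f z) z = c * dir_deriv v f z"
  by (rule dir_derivI) (intro has_derivative_mult_right differentiable_has_derivative_dir_deriv assms)

lemma dir_deriv_add:
  assumes "f differentiable (at z)" "g differentiable (at z)"
  shows "dir_deriv v (\<lambda>z. f z + g z) z = dir_deriv v f z + dir_deriv v g z"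
  by (rule dir_derivI) (intro has_derivative_add differentiable_has_derivative_dir_deriv assms)

lemma dir_deriv_power:
  assumes "f differentiable (at z)"
  shows "dir_deriv v (\<lambda>z. f z ^ k) z = real k * f z ^ (k - 1) * dir_deriv v f z"
proof -
  have "((\<lambda>z. f z ^ k) has_derivative (\<lambda>v. real k * dir_deriv v f z * f z ^ (k - 1))) (at z)"
    by (intro has_derivative_power differentiable_has_derivative_dir_deriv assms)
  from dir_derivI[OF this] show ?thesis by simp
qed

lemma dir_deriv_compose_linear:
  assumes "bounded_linear L" "f differentiable (at (L z))"
  shows "dir_deriv v (\<lambda>z. f (L z)) z = dir_deriv (L v) f (L z)"
proof (rule dir_derivI)
  show "((\<lambda>z. f (L z)) has_derivative (\<lambda>v. dir_deriv (L v) f (L z))) (at z)"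
    using has_derivative_compose[OF bounded_linear_imp_has_derivative[OF assms(1)]
        differentiable_has_derivative_dir_deriv[OF assms(2)]] by simp
qed

lemma Ck_const: "Ck k (\<lambda>_. c)"
proof (induction k arbitrary: c)
  case (Suc k)
  have "dir_deriv v (\<lambda>_. c) = (\<lambda>_. 0)" for v :: 'a
    by (auto intro!: dir_derivI)
  then show ?case using Suc by simp
qed simp

text \<open>Needed for the product rule, whose terms contain one undifferentiated factor that must
  be used at the lower order.\<close>

lemma Ck_Suc_imp_Ck: "Ck (Suc k) f \<Longrightarrow> Ck k f"
proof (induction k arbitrary: f)
  case 0
  then show ?case
    by (auto simp: continuous_on_eq_continuous_at intro!: differentiable_imp_continuous_within)
next
  case (Suc k)
  then show ?case by (metis Ck.simps(2))
qed

lemma Ck_add: "Ck k f \<Longrightarrow> Ck k g \<Longrightarrow> Ck k (\<lambda>z. f z + g z)"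
proof (induction k arbitrary: f g)
  case (Suc k)
  then have d: "f differentiable (at z)" "g differentiable (at z)" for z by auto
  have "dir_deriv v (\<lambda>z. f z + g z) = (\<lambda>z. dir_deriv v f z + dir_deriv v g z)" for v
    using d by (auto intro!: dir_deriv_add)
  then show ?case using Suc d by auto
qed (auto intro: continuous_intros)

lemma Ck_mult: "Ck k f \<Longrightarrow> Ck k g \<Longrightarrow> Ck k (\<lambda>z. f z * g z)"
proof (induction k arbitrary: f g)
  case (Suc k)
  then have d: "f differentiable (at z)" "g differentiable (at z)" for z by auto
  have "dir_deriv v (\<lambda>z. f z * g z) = (\<lambda>z. f z * dir_deriv v g z + dir_deriv v f z * g z)" for v
    using d by (auto intro!: dir_deriv_mult)
  moreover have "Ck k (\<lambda>z. f z * dir_deriv v g z + dir_deriv v f z * g z)" for v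
    using Suc.prems Ck_Suc_imp_Ck by (intro Ck_add Suc.IH) auto
  ultimately show ?case using d by auto
qed (auto intro: continuous_intros)

lemma Ck_compose_linear:
  assumes "bounded_linear L"
  shows "Ck k f \<Longrightarrow> Ck k (\<lambda>z. f (L z))"
proof (induction k arbitrary: f)
  case 0
  then show ?case
    using continuous_on_compose2[of UNIV f UNIV L] bounded_linear.continuous_on[OF assms continuous_on_id]
    by auto
next
  case (Suc k)
  then have d: "f differentiable (at z)" for z by auto
  have "(\<lambda>z. f (L z)) differentiable (at z)" for z
    using differentiable_chain_at[OF bounded_linear_imp_differentiable[OF assms] d] by (simp add: o_def)
  moreover have "dir_deriv v (\<lambda>z. f (L z)) = (\<lambda>z. dir_deriv (L v) f (L z))" for v
    using dir_deriv_compose_linear[OF assms d] by auto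
  ultimately show ?case using Suc by auto
qed

lemma smooth_compose_linear: "smooth f \<Longrightarrow> bounded_linear L \<Longrightarrow> smooth (\<lambda>z. f (L z))"
  unfolding smooth_def using Ck_compose_linear by blast

lemma smooth_mult: "smooth f \<Longrightarrow> smooth g \<Longrightarrow> smooth (\<lambda>z. f z * g z)"
  unfolding smooth_def using Ck_mult by blast

lemma smooth_const: "smooth (\<lambda>_. c)"
  unfolding smooth_def by (auto intro: Ck_const)

lemma smooth_prod: "(\<And>i. i \<in> I \<Longrightarrow> smooth (f i)) \<Longrightarrow> smooth (\<lambda>z. \<Prod>i\<in>I. f i z)"
  by (induction I rule: infinite_finite_induct) (auto intro: smooth_const smooth_mult)

lemma smooth_power: "smooth f \<Longrightarrow> smooth (\<lambda>z. f z ^ k)"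
  by (induction k) (auto intro: smooth_const smooth_mult)

lemma smooth_differentiable: "smooth f \<Longrightarrow> f differentiable (at z)"
  unfolding smooth_def by (metis Ck.simps(2))

lemma smooth_dir_deriv: "smooth f \<Longrightarrow> smooth (dir_deriv v f)"
  unfolding smooth_def by (metis Ck.simps(2))

lemma smooth_continuous: "smooth f \<Longrightarrow> continuous_on UNIV f"
  unfolding smooth_def by (metis Ck.simps(1))

text \<open>Differentiating moves from \<open>H j\<close> to a multiple of \<open>H (Suc j)\<close>,
  so the induction on the order runs over all \<open>j\<close> at once.\<close>

lemma smooth_real:
  assumes "\<And>j x. (H j has_real_derivative H (Suc j) x) (at x)"
  shows "smooth (H j)"
  unfolding smooth_def
proof
  fix k show "Ck k (H j)"
  proof (induction k arbitrary: j)
    case 0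
    then show ?case using DERIV_isCont[OF assms] by (simp add: continuous_at_imp_continuous_on)
  next
    case (Suc k)
    have "H j differentiable (at x)" for x using assms real_differentiable_def by blast
    moreover have "dir_deriv v (H j) = (\<lambda>x. H (Suc j) x * v)" for v
      using assms[of j] by (auto intro!: dir_derivI simp: has_field_derivative_def)
    ultimately show ?case using Suc by (auto intro: Ck_mult Ck_const)
  qed
qed

lemma dir_deriv_zero_outside:
  assumes "closed K" "\<And>z. z \<notin> K \<Longrightarrow> f z = 0" "z \<notin> K"
  shows "dir_deriv v f z = 0"
proof -
  have "((\<lambda>_. 0) has_derivative (\<lambda>_. 0)) (at z)" by simp
  then have "(f has_derivative (\<lambda>_. 0)) (at z)"
    by (rule has_derivative_transform_within_open[of _ _ _ _ "- K"]) (use assms in auto)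
  then show ?thesis by (rule dir_derivI)
qed

section \<open>The operator on powers of a rescaled cutoff\<close>

lemma smooth_compact_support_bounded:
  assumes "smooth f" "compact K" "\<And>z. z \<notin> K \<Longrightarrow> f z = 0"
  obtains B where "0 \<le> B" "\<And>z. \<bar>f z\<bar> \<le> B"
proof -
  have "compact (f ` K)"
    using assms smooth_continuous by (intro compact_continuous_image) (auto intro: continuous_on_subset)
  then obtain B where "\<And>y. y \<in> f ` K \<Longrightarrow> norm y \<le> B" "0 < B"
    using compact_imp_bounded bounded_pos by metis
  then have "\<bar>f z\<bar> \<le> B" for z using assms(3)[of z] by (cases "z \<in> K") auto
  with \<open>0 < B\<close> show thesis by (intro that[of B]) auto
qed

text \<open>The worst term is k (k - 1) f^(k-2) (Df)^2, which loses two powers. The terms that lose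
  only one are put in the same form by f^(k-1) \<le> f^(k-2), valid as 0 \<le> f \<le> 1.\<close>

lemma dir_deriv_power_bounds:
  assumes f: "smooth f" "0 \<le> f z" "f z \<le> 1" and k: "2 \<le> k"
  shows "\<bar>dir_deriv v (\<lambda>z. f z ^ k) z\<bar> \<le> real k * \<bar>dir_deriv v f z\<bar> * f z ^ (k - 2)"
    and "\<bar>dir_deriv v (dir_deriv v (\<lambda>z. f z ^ k)) z\<bar> \<le>
      (real k ^ 2 * (dir_deriv v f z)\<^sup>2 + real k * \<bar>dir_deriv v (dir_deriv v f) z\<bar>) * f z ^ (k - 2)"
proof -
  let ?D = "dir_deriv v f" and ?DD = "dir_deriv v (dir_deriv v f)"
  have le: "f z ^ (k - 1) \<le> f z ^ (k - 2)"
    using f by (intro power_decreasing) auto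
  have one: "dir_deriv v (\<lambda>z. f z ^ k) = (\<lambda>z. (real k * f z ^ (k - 1)) * ?D z)"
    using dir_deriv_power[OF smooth_differentiable[OF f(1)]] by auto
  show "\<bar>dir_deriv v (\<lambda>z. f z ^ k) z\<bar> \<le> real k * \<bar>?D z\<bar> * f z ^ (k - 2)"
    using mult_left_mono[OF le, of "real k * \<bar>?D z\<bar>"] f by (simp add: one abs_mult mult_ac)
  have sm: "smooth (\<lambda>z. real k * f z ^ (k - 1))"
    by (intro smooth_mult smooth_const smooth_power f)
  have "dir_deriv v (\<lambda>z. real k * f z ^ (k - 1)) z = real k * dir_deriv v (\<lambda>z. f z ^ (k - 1)) z"
    by (intro dir_deriv_cmult smooth_differentiable smooth_power f)
  also have "\<dots> = real k * (real (k - 1) * f z ^ (k - 2) * ?D z)"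
    using k by (simp add: dir_deriv_power smooth_differentiable f numeral_2_eq_2)
  finally have two: "dir_deriv v (dir_deriv v (\<lambda>z. f z ^ k)) z =
      real k * f z ^ (k - 1) * ?DD z + real k * (real (k - 1) * f z ^ (k - 2) * ?D z) * ?D z"
    unfolding one by (simp add: dir_deriv_mult smooth_differentiable sm smooth_dir_deriv f)
  have a: "\<bar>real k * f z ^ (k - 1) * ?DD z\<bar> \<le> real k * \<bar>?DD z\<bar> * f z ^ (k - 2)"
    using mult_left_mono[OF le, of "real k * \<bar>?DD z\<bar>"] f by (simp add: abs_mult mult_ac)
  have "\<bar>real k * (real (k - 1) * f z ^ (k - 2) * ?D z) * ?D z\<bar> = (real k * real (k - 1)) * ((?D z)\<^sup>2 * f z ^ (k - 2))"
    using f by (simp add: abs_mult power2_eq_square)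
  also have "\<dots> \<le> (real k * real k) * ((?D z)\<^sup>2 * f z ^ (k - 2))"
    using f by (intro mult_right_mono mult_left_mono) auto
  finally have b: "\<bar>real k * (real (k - 1) * f z ^ (k - 2) * ?D z) * ?D z\<bar> \<le> real k ^ 2 * (?D z)\<^sup>2 * f z ^ (k - 2)"
    by (simp add: power2_eq_square mult_ac)
  show "\<bar>dir_deriv v (dir_deriv v (\<lambda>z. f z ^ k)) z\<bar> \<le>
      (real k ^ 2 * (?D z)\<^sup>2 + real k * \<bar>?DD z\<bar>) * f z ^ (k - 2)"
    unfolding two distrib_right using abs_triangle_ineq a b by (smt (verit))
qed

text \<open>The heat scaling: the damping term and the Laplacian both gain 1/R, while the second
  time derivative gains 1/R^2 and is of lower order for large R.\<close>

definition parabolic_scaling :: "real \<Rightarrow> real \<times> 'a::real_normed_vector \<Rightarrow> real \<times> 'a" where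
  "parabolic_scaling R z = (fst z / R, snd z /\<^sub>R sqrt R)"

lemma bounded_linear_parabolic_scaling: "bounded_linear (parabolic_scaling R)"
proof -
  have "bounded_linear (\<lambda>z::real \<times> 'a. (fst z / R, (inverse (sqrt R)) *\<^sub>R snd z))"
    by (intro bounded_linear_Pair bounded_linear_compose[OF bounded_linear_divide]
        bounded_linear_compose[OF bounded_linear_scaleR_right] bounded_linear_fst bounded_linear_snd)
  then show ?thesis by (simp add: parabolic_scaling_def[abs_def])
qed

lemma scaled_power_operator_bound:
  fixes \<Phi> :: "real \<times> 'a::euclidean_space \<Rightarrow> real"
  assumes \<Phi>: "smooth \<Phi>" "\<And>z. 0 \<le> \<Phi> z" "\<And>z. \<Phi> z \<le> 1"
    and K: "compact K" "\<And>z. z \<notin> K \<Longrightarrow> \<Phi> z = 0" and k: "2 \<le> k"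
  obtains C where "0 < C"
    "\<And>R z. 1 \<le> R \<Longrightarrow> \<bar>time_deriv (time_deriv (\<lambda>z. \<Phi> (parabolic_scaling R z) ^ k)) z
        - time_deriv (\<lambda>z. \<Phi> (parabolic_scaling R z) ^ k) z
        - laplacian (\<lambda>z. \<Phi> (parabolic_scaling R z) ^ k) z\<bar> \<le> C / R * \<Phi> (parabolic_scaling R z) ^ (k - 2)"
proof -
  let ?V = "insert (1, 0) ((\<lambda>b. (0, b)) ` Basis) :: (real \<times> 'a) set"
  have cl: "closed K" using K(1) by (rule compact_imp_closed)
  have "\<exists>B. 0 \<le> B \<and> (\<forall>z. \<bar>dir_deriv v \<Phi> z\<bar> \<le> B) \<and> (\<forall>z. \<bar>dir_deriv v (dir_deriv v \<Phi>) z\<bar> \<le> B)" for v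
  proof -
    have D: "dir_deriv v \<Phi> z = 0" if "z \<notin> K" for z by (rule dir_deriv_zero_outside[OF cl K(2) that])
    have DD: "dir_deriv v (dir_deriv v \<Phi>) z = 0" if "z \<notin> K" for z by (rule dir_deriv_zero_outside[OF cl D that])
    obtain B1 where "0 \<le> B1" "\<And>z. \<bar>dir_deriv v \<Phi> z\<bar> \<le> B1"
      using smooth_compact_support_bounded[OF smooth_dir_deriv[OF \<Phi>(1)] K(1) D] by blast
    moreover obtain B2 where "0 \<le> B2" "\<And>z. \<bar>dir_deriv v (dir_deriv v \<Phi>) z\<bar> \<le> B2"
      using smooth_compact_support_bounded[OF smooth_dir_deriv[OF smooth_dir_deriv[OF \<Phi>(1)]] K(1) DD] by blast
    ultimately show ?thesis
      by (intro exI[of _ "max B1 B2"]) (auto simp: le_max_iff_disj)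
  qed
  then obtain Bv where Bv: "\<And>v. 0 \<le> Bv v" "\<And>v z. \<bar>dir_deriv v \<Phi> z\<bar> \<le> Bv v"
    "\<And>v z. \<bar>dir_deriv v (dir_deriv v \<Phi>) z\<bar> \<le> Bv v"
    by metis
  define B where "B = (\<Sum>v\<in>?V. Bv v)"
  have B: "Bv v \<le> B" if "v \<in> ?V" for v
    unfolding B_def by (rule member_le_sum) (use that Bv in auto)
  have B0: "0 \<le> B" unfolding B_def by (intro sum_nonneg Bv)
  define Q where "Q = real k ^ 2 * B\<^sup>2 + real k * B"
  have Q0: "0 \<le> Q" using B0 by (simp add: Q_def)
  \<comment> \<open>One summand for each of the three terms of the operator; the 1 makes
    \<open>C\<close> positive.\<close>
  define C where "C = Q + real k * B + DIM('a) * Q + 1"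
  have C: "0 < C" using B0 Q0 by (simp add: C_def add_nonneg_pos)
  have main: "\<bar>time_deriv (time_deriv (\<lambda>z. \<Phi> (parabolic_scaling R z) ^ k)) z
        - time_deriv (\<lambda>z. \<Phi> (parabolic_scaling R z) ^ k) z
        - laplacian (\<lambda>z. \<Phi> (parabolic_scaling R z) ^ k) z\<bar> \<le> C / R * \<Phi> (parabolic_scaling R z) ^ (k - 2)"
    if R: "1 \<le> R" for R z
  proof -
    let ?L = "parabolic_scaling R :: real \<times> 'a \<Rightarrow> real \<times> 'a"
    let ?f = "\<lambda>z. \<Phi> (?L z)"
    have f: "smooth ?f" "0 \<le> ?f z" "?f z \<le> 1"
      using \<Phi> smooth_compose_linear[OF \<Phi>(1) bounded_linear_parabolic_scaling] by auto
    \<comment> \<open>Along an eigenvector of the scaling the chain rule only produces the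
      eigenvalue \<open>c\<close>, which is 1/R in time and 1/sqrt R in each space
      direction.\<close>
    have scale1: "dir_deriv v ?f = (\<lambda>z. c * dir_deriv v \<Phi> (?L z))" if "?L v = c *\<^sub>R v" for v c
      using dir_deriv_compose_linear[OF bounded_linear_parabolic_scaling smooth_differentiable[OF \<Phi>(1)]] that
      by (simp add: fun_eq_iff dir_deriv_scaleR smooth_differentiable \<Phi>(1))
    have scale2: "dir_deriv v (dir_deriv v ?f) z = c\<^sup>2 * dir_deriv v (dir_deriv v \<Phi>) (?L z)" if "?L v = c *\<^sub>R v" for v c
    proof -
      have s: "smooth (\<lambda>z. dir_deriv v \<Phi> (?L z))"
        by (rule smooth_compose_linear[OF smooth_dir_deriv[OF \<Phi>(1)] bounded_linear_parabolic_scaling])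
      have "dir_deriv v (\<lambda>z. c * dir_deriv v \<Phi> (?L z)) z = c * dir_deriv v (\<lambda>z. dir_deriv v \<Phi> (?L z)) z"
        by (intro dir_deriv_cmult smooth_differentiable s)
      also have "\<dots> = c * (c * dir_deriv v (dir_deriv v \<Phi>) (?L z))"
        using dir_deriv_compose_linear[OF bounded_linear_parabolic_scaling smooth_differentiable[OF smooth_dir_deriv[OF \<Phi>(1)]]] that
        by (simp add: dir_deriv_scaleR smooth_differentiable smooth_dir_deriv \<Phi>(1))
      finally show ?thesis by (simp add: scale1[OF that] power2_eq_square)
    qed
    have second: "\<bar>dir_deriv v (dir_deriv v (\<lambda>z. ?f z ^ k)) z\<bar> \<le> Q / R * ?f z ^ (k - 2)"
      if "?L v = c *\<^sub>R v" "v \<in> ?V" "c\<^sup>2 \<le> 1 / R" for v c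
    proof -
      have "(dir_deriv v \<Phi> (?L z))\<^sup>2 \<le> B\<^sup>2"
        using Bv(2)[of v "?L z"] B[OF that(2)] B0 by (simp add: abs_le_square_iff[symmetric])
      moreover have "\<bar>dir_deriv v (dir_deriv v \<Phi>) (?L z)\<bar> \<le> B"
        using Bv(3)[of v "?L z"] B[OF that(2)] by linarith
      ultimately have "real k ^ 2 * (dir_deriv v \<Phi> (?L z))\<^sup>2 + real k * \<bar>dir_deriv v (dir_deriv v \<Phi>) (?L z)\<bar> \<le> Q"
        unfolding Q_def by (intro add_mono mult_left_mono) auto
      then have "c\<^sup>2 * (real k ^ 2 * (dir_deriv v \<Phi> (?L z))\<^sup>2 + real k * \<bar>dir_deriv v (dir_deriv v \<Phi>) (?L z)\<bar>) \<le> 1 / R * Q"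
        using that(3) R by (intro mult_mono) auto
      then have "real k ^ 2 * (dir_deriv v ?f z)\<^sup>2 + real k * \<bar>dir_deriv v (dir_deriv v ?f) z\<bar> \<le> Q / R"
        by (simp add: fun_cong[OF scale1[OF that(1)], of z] scale2[OF that(1)] abs_mult power_mult_distrib algebra_simps)
      then show ?thesis
        using dir_deriv_power_bounds(2)[OF f k, of v] mult_right_mono[of _ "Q / R" "?f z ^ (k - 2)"] f(2)
        by (meson order_trans zero_le_power)
    qed
    have Lt: "?L (1, 0) = (1 / R) *\<^sub>R (1, 0)" by (simp add: parabolic_scaling_def)
    have Lx: "?L (0, b) = (1 / sqrt R) *\<^sub>R (0, b)" for b by (simp add: parabolic_scaling_def divide_inverse)
    have "(1 / R)\<^sup>2 \<le> 1 / R" using R by (simp add: power2_eq_square field_simps)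
    then have tt: "\<bar>time_deriv (time_deriv (\<lambda>z. ?f z ^ k)) z\<bar> \<le> Q / R * ?f z ^ (k - 2)"
      unfolding time_deriv_def by (intro second[OF Lt]) auto
    have t: "\<bar>time_deriv (\<lambda>z. ?f z ^ k) z\<bar> \<le> real k * B / R * ?f z ^ (k - 2)"
    proof -
      have "\<bar>dir_deriv (1, 0) \<Phi> (?L z)\<bar> \<le> B" by (rule order_trans[OF Bv(2) B]) simp
      then have "real k * \<bar>dir_deriv (1, 0) ?f z\<bar> \<le> real k * B / R"
        using R mult_left_mono[of _ B "real k"] by (simp add: scale1[OF Lt] abs_mult divide_right_mono)
      then show ?thesis
        unfolding time_deriv_def
        using dir_deriv_power_bounds(1)[OF f k, of "(1,0)"] mult_right_mono[of _ "real k * B / R" "?f z ^ (k - 2)"] f(2)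
        by (meson order_trans zero_le_power)
    qed
    have x: "\<bar>laplacian (\<lambda>z. ?f z ^ k) z\<bar> \<le> DIM('a) * (Q / R * ?f z ^ (k - 2))"
      unfolding laplacian_def
      using R by (intro order_trans[OF sum_abs] sum_bounded_above second[OF Lx]) (auto simp: power_divide)
    have nonneg: "0 \<le> ?f z ^ (k - 2) / R" using f(2) R by simp
    have "\<bar>u - v - w\<bar> \<le> \<bar>u\<bar> + \<bar>v\<bar> + \<bar>w\<bar>" for u v w :: real by linarith
    note this[of "time_deriv (time_deriv (\<lambda>z. ?f z ^ k)) z" "time_deriv (\<lambda>z. ?f z ^ k) z" "laplacian (\<lambda>z. ?f z ^ k) z"]
    also note add_mono[OF add_mono[OF tt t] x]
    also have "Q / R * ?f z ^ (k - 2) + real k * B / R * ?f z ^ (k - 2) + DIM('a) * (Q / R * ?f z ^ (k - 2))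
        = (Q + real k * B + DIM('a) * Q) * (?f z ^ (k - 2) / R)"
      by (simp add: distrib_right add_divide_distrib mult.assoc)
    also have "\<dots> \<le> C * (?f z ^ (k - 2) / R)"
      unfolding C_def by (intro mult_right_mono nonneg) auto
    finally show ?thesis by simp
  qed
  show thesis using that[OF C main] by blast
qed

lemma has_real_derivative_along:
  assumes "f differentiable (at z)"
  shows "((\<lambda>s. f (z + s *\<^sub>R v)) has_real_derivative dir_deriv v f z) (at 0)"
proof -
  have "((\<lambda>s::real. z + s *\<^sub>R v) has_derivative (\<lambda>s. s *\<^sub>R v)) (at 0)"
    by (auto intro!: derivative_eq_intros)
  from has_derivative_compose[OF this, of f "\<lambda>v. dir_deriv v f z"] assms
  have "((\<lambda>s. f (z + s *\<^sub>R v)) has_derivative (\<lambda>s. dir_deriv (s *\<^sub>R v) f z)) (at 0)"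
    by (simp add: differentiable_has_derivative_dir_deriv)
  then show ?thesis
    by (simp add: has_field_derivative_def dir_deriv_scaleR[OF assms] mult_commute_abs)
qed

text \<open>The operator bound is relative to \<open>\<psi> powr (1 / p)\<close> because Young's
  inequality turns |u| times this factor into |u|^p \<psi>. Since the bump equals 1 at 0, the trace
  at t = 0 is a pure product over the coordinates, with \<open>h\<close> the k-th power of the bump;
  its density is then a tensor product. The radius 4 of the bump becomes 4 R in time and 4 sqrt R in
  space.\<close>

lemma test_function_family:
  fixes p :: real
  assumes "1 < p"
  obtains \<psi> :: "real \<Rightarrow> real \<times> 'a::euclidean_space \<Rightarrow> real" and C h g where
    "0 < C" "fourier_pos h g" "\<And>x. 4 \<le> \<bar>x\<bar> \<Longrightarrow> h x = 0"
    "\<And>R. smooth (\<psi> R)" "\<And>R z. 0 \<le> \<psi> R z" "\<And>R z. \<psi> R z \<le> 1"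
    "\<And>R t x. 1 \<le> R \<Longrightarrow> 4 * R < \<bar>t\<bar> \<Longrightarrow> \<psi> R (t, x) = 0"
    "\<And>R t x b. 1 \<le> R \<Longrightarrow> b \<in> Basis \<Longrightarrow> 4 * sqrt R < \<bar>x \<bullet> b\<bar> \<Longrightarrow> \<psi> R (t, x) = 0"
    "\<And>R x. 1 \<le> R \<Longrightarrow> time_deriv (\<psi> R) (0, x) = 0"
    "\<And>R x. \<psi> R (0, x) = (\<Prod>b\<in>Basis. h ((x \<bullet> b) / sqrt R))"
    "\<And>R z. 1 \<le> R \<Longrightarrow> \<bar>time_deriv (time_deriv (\<psi> R)) z - time_deriv (\<psi> R) z - laplacian (\<psi> R) z\<bar>
       \<le> C / R * \<psi> R z powr (1 / p)"
proof -
  obtain H :: "nat \<Rightarrow> real \<Rightarrow> real" and g0 where H: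
    "\<And>j x. (H j has_real_derivative H (Suc j) x) (at x)"
    "\<And>x. 0 \<le> H 0 x" "\<And>x. H 0 x \<le> 1" "\<And>x. 4 \<le> \<bar>x\<bar> \<Longrightarrow> H 0 x = 0" "H 0 0 = 1" "H 1 0 = 0"
    "fourier_pos (H 0) g0"
    using smooth_bump_exists by metis
  define \<Phi> where "\<Phi> = (\<lambda>z::real \<times> 'a. H 0 (fst z) * (\<Prod>b\<in>Basis. H 0 (snd z \<bullet> b)))"
  have smooth: "smooth \<Phi>"
    unfolding \<Phi>_def
  proof (intro smooth_mult smooth_prod)
    show "smooth (\<lambda>z::real \<times> 'a. H 0 (fst z))"
      by (rule smooth_compose_linear[OF smooth_real[of H, OF H(1)] bounded_linear_fst])
    show "smooth (\<lambda>z::real \<times> 'a. H 0 (snd z \<bullet> b))" for b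
      by (rule smooth_compose_linear[OF smooth_real[of H, OF H(1)]
            bounded_linear_compose[OF bounded_linear_inner_left bounded_linear_snd]])
  qed
  have nonneg: "0 \<le> \<Phi> z" for z by (simp add: \<Phi>_def H prod_nonneg)
  have le1: "\<Phi> z \<le> 1" for z
    unfolding \<Phi>_def by (intro mult_le_one prod_le_1 prod_nonneg conjI H)
  have z1: "\<Phi> z = 0" if "4 \<le> \<bar>fst z\<bar>" for z :: "real \<times> 'a" using that H by (simp add: \<Phi>_def)
  have z2: "\<Phi> z = 0" if "b \<in> Basis" "4 \<le> \<bar>snd z \<bullet> b\<bar>" for z :: "real \<times> 'a" and b
    using that H(4) by (auto simp: \<Phi>_def)
  define K where "K = cbox (-4 :: real, - (4 *\<^sub>R One)) (4, 4 *\<^sub>R (One::'a))"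
  have outside: "\<Phi> z = 0" if "z \<notin> K" for z
  proof (cases "4 \<le> \<bar>fst z\<bar>")
    case False
    with that have "snd z \<notin> cbox (- (4 *\<^sub>R One)) (4 *\<^sub>R One)"
      by (cases z) (auto simp: K_def cbox_Pair_eq)
    then obtain b where "b \<in> Basis" "4 \<le> \<bar>snd z \<bullet> b\<bar>"
      by (auto simp: mem_box)
    then show ?thesis by (rule z2)
  qed (rule z1)
  \<comment> \<open>Two derivatives of \<open>\<Phi> ^ k\<close> cost two powers of \<open>\<Phi>\<close>, which \<open>\<psi> powr (1 / p)\<close> can afford as soon as \<open>k - 2 \<ge> k / p\<close>.\<close>
  obtain k :: nat where k: "3 \<le> k" "real k * (1 - 1 / p) \<ge> 2"
  proof -
    obtain k0 :: nat where k0: "2 / (1 - 1 / p) \<le> real k0" using real_arch_simple by blast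
    have "0 < 1 - 1 / p" using assms by simp
    then have "2 \<le> real (k0 + 3) * (1 - 1 / p)"
      using k0 by (simp add: pos_divide_le_eq distrib_right)
    then show thesis by (intro that[of "k0 + 3"]) auto
  qed
  have "2 \<le> k" using k by simp
  obtain C where C: "0 < C" and bound:
    "\<And>R z. 1 \<le> R \<Longrightarrow> \<bar>time_deriv (time_deriv (\<lambda>z. \<Phi> (parabolic_scaling R z) ^ k)) z
        - time_deriv (\<lambda>z. \<Phi> (parabolic_scaling R z) ^ k) z
        - laplacian (\<lambda>z. \<Phi> (parabolic_scaling R z) ^ k) z\<bar> \<le> C / R * \<Phi> (parabolic_scaling R z) ^ (k - 2)"
    using scaled_power_operator_bound[OF smooth nonneg le1 compact_cbox outside[unfolded K_def] \<open>2 \<le> k\<close>] by metis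
  \<comment> \<open>At y = 0 the right side is 0; \<open>k \<ge> 3\<close> makes the left side
    vanish too, whereas \<open>k = 2\<close> would give 0^0 = 1.\<close>
  have power_le: "y ^ (k - 2) \<le> (y ^ k) powr (1 / p)" if "0 \<le> y" "y \<le> 1" for y :: real
  proof (cases "y = 0")
    case False
    then have "y ^ (k - 2) = y powr real (k - 2)" using that by (simp add: powr_realpow)
    also have "\<dots> \<le> y powr (real k * (1 / p))"
      using that False k by (intro powr_mono') (auto simp: of_nat_diff algebra_simps)
    also have "\<dots> = (y ^ k) powr (1 / p)"
      using that False by (simp add: powr_realpow[symmetric] powr_powr)
    finally show ?thesis .
  qed (use k in \<open>simp add: power_0_left\<close>)
  define \<psi> where "\<psi> = (\<lambda>R z. \<Phi> (parabolic_scaling R z) ^ k)"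
  obtain g where g: "fourier_pos (\<lambda>x. H 0 x ^ k) g"
    using fourier_pos_power[OF H(7), of "k - 1"] k by auto
  show thesis
  proof (rule that[OF C g, of \<psi>])
    show "H 0 x ^ k = 0" if "4 \<le> \<bar>x\<bar>" for x using H(4)[OF that] k by simp
    show sm: "smooth (\<psi> R)" for R
      unfolding \<psi>_def by (rule smooth_power[OF smooth_compose_linear[OF smooth bounded_linear_parabolic_scaling]])
    show "0 \<le> \<psi> R z" "\<psi> R z \<le> 1" for R z by (simp_all add: \<psi>_def nonneg le1 power_le_one)
    show "\<psi> R (t, x) = 0" if "1 \<le> R" "4 * R < \<bar>t\<bar>" for R t x
      using that k by (simp add: \<psi>_def parabolic_scaling_def z1 field_simps)
    show "\<psi> R (t, x) = 0" if "1 \<le> R" "b \<in> Basis" "4 * sqrt R < \<bar>x \<bullet> b\<bar>" for R t x b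
    proof -
      have "4 \<le> \<bar>snd (parabolic_scaling R (t, x)) \<bullet> b\<bar>"
        using that by (simp add: parabolic_scaling_def abs_mult field_simps)
      then show ?thesis using z2[OF that(2)] k by (simp add: \<psi>_def)
    qed
    show "\<psi> R (0, x) = (\<Prod>b\<in>Basis. H 0 ((x \<bullet> b) / sqrt R) ^ k)" for R x
      by (simp add: \<psi>_def parabolic_scaling_def \<Phi>_def H(5) power_mult_distrib prod_power_distrib divide_inverse mult.commute)
    show "time_deriv (\<psi> R) (0, x) = 0" if "1 \<le> R" for R x
    proof -
      \<comment> \<open>With the spatial factors frozen in \<open>c\<close>, the time derivative at
        0 carries the factor \<open>H 1 0 = 0\<close>.\<close>
      define c where "c = (\<Prod>b\<in>Basis. H 0 ((x /\<^sub>R sqrt R) \<bullet> b))"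
      have "((\<lambda>s. s / R) has_real_derivative 1 / R) (at 0)" by (intro DERIV_cdivide DERIV_ident)
      with H(1)[of 0 0] have "((\<lambda>s. H 0 (s / R)) has_real_derivative H 1 0 * (1 / R)) (at 0)"
        using DERIV_chain2[of "H 0" "H 1 0" "\<lambda>s. s / R" 0 "1 / R" UNIV] by simp
      then have "((\<lambda>s. H 0 (s / R)) has_real_derivative 0) (at 0)" by (simp only: H(6) mult_zero_left)
      then have "((\<lambda>s. (H 0 (s / R) * c) ^ k) has_real_derivative 0) (at 0)"
        by (auto intro!: derivative_eq_intros)
      moreover have "(\<lambda>s. (H 0 (s / R) * c) ^ k) = (\<lambda>s. \<psi> R ((0, x) + s *\<^sub>R (1, 0)))"
        by (simp add: \<psi>_def parabolic_scaling_def \<Phi>_def c_def)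
      ultimately show ?thesis
        using DERIV_unique[OF has_real_derivative_along[OF smooth_differentiable[OF sm]]]
        unfolding time_deriv_def by fastforce
    qed
    show "\<bar>time_deriv (time_deriv (\<psi> R)) z - time_deriv (\<psi> R) z - laplacian (\<psi> R) z\<bar>
       \<le> C / R * \<psi> R z powr (1 / p)" if "1 \<le> R" for R z
      unfolding \<psi>_def
      by (rule order_trans[OF bound[OF that]], intro mult_left_mono power_le nonneg le1) (use C that in auto)
  qed
qed

section \<open>Fourier pairing and the data term\<close>

lemma
  fixes f :: "'a::euclidean_space \<Rightarrow> real \<Rightarrow> 'c::{real_normed_field, banach, second_countable_topology}"
  assumes f: "\<And>b. b \<in> Basis \<Longrightarrow> integrable lborel (f b)"
  shows integrable_prod_Basis: "integrable lborel (\<lambda>x. \<Prod>b\<in>Basis. f b (x \<bullet> b))"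
    and integral_prod_Basis: "(\<integral>x. (\<Prod>b\<in>Basis. f b (x \<bullet> b)) \<partial>lborel) = (\<Prod>b\<in>Basis. \<integral>t. f b t \<partial>lborel)"
proof -
  interpret product_sigma_finite "\<lambda>_::'a. lborel :: real measure"
    by (simp add: product_sigma_finite_def lborel.sigma_finite_measure_axioms)
  let ?T = "\<lambda>y. \<Sum>b\<in>Basis. y b *\<^sub>R (b::'a)"
  have meas: "(\<lambda>x. \<Prod>b\<in>Basis. f b (x \<bullet> b)) \<in> borel_measurable borel"
  proof (intro borel_measurable_prod)
    fix b :: 'a assume "b \<in> Basis"
    then have [measurable]: "f b \<in> borel_measurable borel" using borel_measurable_integrable[OF f] by simp
    show "(\<lambda>x. f b (x \<bullet> b)) \<in> borel_measurable borel" by measurable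
  qed
  have T: "?T \<in> measurable (\<Pi>\<^sub>M b\<in>Basis. lborel) borel"
    by measurable
  have comp: "(\<Prod>b\<in>Basis. f b (?T y \<bullet> b)) = (\<Prod>b\<in>Basis. f b (y b))" for y
    by (intro prod.cong refl) (simp add: inner_sum_left inner_Basis if_distrib[of "\<lambda>x. _ * x"] cong: if_cong)
  show "integrable lborel (\<lambda>x. \<Prod>b\<in>Basis. f b (x \<bullet> b))"
    by (subst lborel_eq, subst integrable_distr_eq[OF T meas], unfold comp)
      (rule product_integrable_prod[OF finite_Basis f])
  show "(\<integral>x. (\<Prod>b\<in>Basis. f b (x \<bullet> b)) \<partial>lborel) = (\<Prod>b\<in>Basis. \<integral>t. f b t \<partial>lborel)"
    by (subst lborel_eq, subst integral_distr[OF T meas], unfold comp)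
      (rule product_integral_prod[OF finite_Basis f])
qed

lemma fourier_char_sum: "fourier_char (\<Sum>i\<in>I. t i) = (\<Prod>i\<in>I. fourier_char (t i))"
  by (induction I rule: infinite_finite_induct) (simp_all add: fourier_char_add, simp_all add: fourier_char_def)

lemma fourier_pos_prod_Basis:
  fixes x :: "'a::euclidean_space"
  assumes "fourier_pos h g"
  shows "complex_of_real (\<Prod>b\<in>Basis. h (x \<bullet> b)) =
    (\<integral>\<xi>. fourier_char (x \<bullet> \<xi>) * of_real (\<Prod>b\<in>Basis. g (\<xi> \<bullet> b)) \<partial>lborel)"
proof -
  have g: "integrable lborel g" using assms by (simp add: fourier_pos_def)
  have int: "integrable lborel (\<lambda>\<xi>. fourier_char (s * \<xi>) * complex_of_real (g \<xi>))" for s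
  proof -
    have [measurable]: "g \<in> borel_measurable borel" using borel_measurable_integrable[OF g] by simp
    show ?thesis
      by (rule Bochner_Integration.integrable_bound[OF g]) (auto simp: norm_mult)
  qed
  have "complex_of_real (\<Prod>b\<in>Basis. h (x \<bullet> b)) =
    (\<Prod>b\<in>Basis. \<integral>\<xi>. fourier_char ((x \<bullet> b) * \<xi>) * complex_of_real (g \<xi>) \<partial>lborel)"
    using assms by (simp add: fourier_pos_def)
  also have "\<dots> = (\<integral>\<xi>. (\<Prod>b\<in>Basis. fourier_char ((x \<bullet> b) * (\<xi> \<bullet> b)) * complex_of_real (g (\<xi> \<bullet> b))) \<partial>(lborel :: 'a measure))"
    by (rule integral_prod_Basis[symmetric]) (rule int)
  also have "\<dots> = (\<integral>\<xi>. fourier_char (x \<bullet> \<xi>) * of_real (\<Prod>b\<in>Basis. g (\<xi> \<bullet> b)) \<partial>lborel)"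
  proof (intro Bochner_Integration.integral_cong refl)
    fix \<xi> :: 'a
    have "fourier_char (x \<bullet> \<xi>) = (\<Prod>b\<in>Basis. fourier_char ((x \<bullet> b) * (\<xi> \<bullet> b)))"
      by (subst euclidean_inner) (rule fourier_char_sum)
    then show "(\<Prod>b\<in>Basis. fourier_char ((x \<bullet> b) * (\<xi> \<bullet> b)) * complex_of_real (g (\<xi> \<bullet> b))) =
        fourier_char (x \<bullet> \<xi>) * of_real (\<Prod>b\<in>Basis. g (\<xi> \<bullet> b))"
      by (simp add: prod.distrib)
  qed
  finally show ?thesis .
qed

text \<open>The data and their transforms are only Lebesgue measurable, so Fubini is applied to a
  product of two completed measures.\<close>

lemma sigma_finite_lebesgue: "sigma_finite_measure (lebesgue :: 'a::euclidean_space measure)"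
proof
  let ?A = "range (\<lambda>n::nat. cbox (- (real n *\<^sub>R One)) (real n *\<^sub>R One :: 'a))"
  have "x \<in> \<Union>?A" for x :: 'a
  proof -
    obtain n where "norm x \<le> real n" using real_arch_simple by blast
    then have "x \<in> cbox (- (real n *\<^sub>R One)) (real n *\<^sub>R One)"
      using order_trans[OF Basis_le_norm] by (force simp: mem_box abs_le_iff minus_le_iff)
    then show ?thesis by blast
  qed
  then show "\<exists>A. countable A \<and> A \<subseteq> sets (lebesgue :: 'a measure) \<and> \<Union> A = space lebesgue \<and> (\<forall>a\<in>A. emeasure lebesgue a \<noteq> \<infinity>)"
    by (intro exI[of _ ?A]) (auto simp: fmeasurableD2[OF lmeasurable_cbox])
qed

lemma measurable_ident_lebesgue_borel: "(\<lambda>x. x) \<in> measurable (lebesgue :: 'a::euclidean_space measure) borel"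
  by (rule measurable_completion) simp

lemma L2_space_mult_integrable:
  assumes "w \<in> L2_space" "\<Gamma> \<in> borel_measurable lebesgue" "integrable lebesgue (\<lambda>\<xi>. (\<Gamma> \<xi> :: real)\<^sup>2)"
  shows "integrable lebesgue (\<lambda>\<xi>. w \<xi> * complex_of_real (\<Gamma> \<xi>))"
proof (rule Bochner_Integration.integrable_bound)
  show "integrable lebesgue (\<lambda>\<xi>. (cmod (w \<xi>))\<^sup>2 + (\<Gamma> \<xi>)\<^sup>2)"
    using assms by (auto simp: L2_space_def)
  show "(\<lambda>\<xi>. w \<xi> * complex_of_real (\<Gamma> \<xi>)) \<in> borel_measurable lebesgue"
    using assms by (auto simp: L2_space_def)
  have "cmod (w \<xi>) * \<bar>\<Gamma> \<xi>\<bar> \<le> (cmod (w \<xi>))\<^sup>2 + (\<Gamma> \<xi>)\<^sup>2" for \<xi>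
  proof -
    have "2 * (cmod (w \<xi>) * \<bar>\<Gamma> \<xi>\<bar>) \<le> (cmod (w \<xi>))\<^sup>2 + (\<Gamma> \<xi>)\<^sup>2"
      using zero_le_power2[of "cmod (w \<xi>) - \<bar>\<Gamma> \<xi>\<bar>"] unfolding power2_diff by simp
    moreover have "0 \<le> cmod (w \<xi>) * \<bar>\<Gamma> \<xi>\<bar>" by simp
    ultimately show ?thesis by linarith
  qed
  then show "AE \<xi> in lebesgue. norm (w \<xi> * complex_of_real (\<Gamma> \<xi>)) \<le> norm ((cmod (w \<xi>))\<^sup>2 + (\<Gamma> \<xi>)\<^sup>2)"
    by (simp add: norm_mult)
qed

text \<open>The multiplication formula for an L^2 function and a bounded integrable density. On a
  ball \<open>f\<close> is integrable, so Fubini gives the formula for the truncated transform; as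
  \<phi> vanishes outside radius \<rho>, truncation at any R \<ge> \<rho> leaves the right-hand side
  unchanged. By Cauchy-Schwarz the remaining error is at most the L^2 distance from \<open>w\<close>
  to the truncated transform times the norm of \<Gamma>.\<close>

lemma fourier_transform_pairing:
  fixes f w :: "'a::euclidean_space \<Rightarrow> complex" and \<Gamma> :: "'a \<Rightarrow> real"
  assumes ft: "has_fourier_transform f w"
    and \<Gamma>: "integrable lborel \<Gamma>" "\<And>\<xi>. 0 \<le> \<Gamma> \<xi>" "\<And>\<xi>. \<Gamma> \<xi> \<le> M"
    and \<phi>: "\<And>x. \<phi> x = (\<integral>\<xi>. fourier_char (x \<bullet> \<xi>) * of_real (\<Gamma> \<xi>) \<partial>lborel)"
    and supp: "\<And>x. \<rho> < norm x \<Longrightarrow> \<phi> x = 0"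
  shows "(\<integral>\<xi>. w \<xi> * of_real (\<Gamma> \<xi>) \<partial>lebesgue) =
    of_real ((2 * pi) powr (- real DIM('a) / 2)) * (\<integral>x. f x * \<phi> x \<partial>lebesgue)"
    and "integrable lebesgue (\<lambda>\<xi>. w \<xi> * complex_of_real (\<Gamma> \<xi>))"
proof -
  define \<kappa> where "\<kappa> = complex_of_real ((2 * pi) powr (- real DIM('a) / 2))"
  interpret L: sigma_finite_measure "lebesgue :: 'a measure" by (rule sigma_finite_lebesgue)
  interpret LP: pair_sigma_finite "lebesgue :: 'a measure" "lebesgue :: 'a measure" ..
  have f: "f \<in> borel_measurable lebesgue" "integrable lebesgue (\<lambda>x. (cmod (f x))\<^sup>2)"
    and w: "w \<in> L2_space" "w \<in> borel_measurable lebesgue"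
    and lim: "((\<lambda>R. \<integral>\<^sup>+ \<xi>. ennreal ((cmod (w \<xi> - truncated_fourier R f \<xi>))\<^sup>2) \<partial>lebesgue) \<longlongrightarrow> 0) at_top"
    using ft by (auto simp: has_fourier_transform_def L2_space_def)
  note [measurable] = f(1) w(2)
  have \<Gamma>b: "\<Gamma> \<in> borel_measurable borel" using borel_measurable_integrable[OF \<Gamma>(1)] by simp
  then have [measurable]: "\<Gamma> \<in> borel_measurable lebesgue" by (simp add: measurable_completion)
  have \<Gamma>l: "integrable lebesgue \<Gamma>" using \<Gamma>(1) \<Gamma>b by (simp add: integrable_completion)
  have \<Gamma>2: "integrable lebesgue (\<lambda>\<xi>. (\<Gamma> \<xi>)\<^sup>2)"
  proof (rule Bochner_Integration.integrable_bound)
    show "integrable lebesgue (\<lambda>\<xi>. M * \<Gamma> \<xi>)" using \<Gamma>l by simp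
    show "AE \<xi> in lebesgue. norm ((\<Gamma> \<xi>)\<^sup>2) \<le> norm (M * \<Gamma> \<xi>)"
      using \<Gamma> order_trans[OF \<Gamma>(2,3)] by (auto simp: power2_eq_square intro!: mult_right_mono)
  qed measurable
  show w\<Gamma>: "integrable lebesgue (\<lambda>\<xi>. w \<xi> * complex_of_real (\<Gamma> \<xi>))"
    by (intro L2_space_mult_integrable w \<Gamma>2) measurable
  have \<phi>': "\<phi> x = (\<integral>\<xi>. fourier_char (x \<bullet> \<xi>) * of_real (\<Gamma> \<xi>) \<partial>lebesgue)" for x
    unfolding \<phi> by (rule integral_completion[symmetric]) (use \<Gamma>b in measurable)
  define D where "D = (\<integral>\<xi>. w \<xi> * of_real (\<Gamma> \<xi>) \<partial>lebesgue) - \<kappa> * (\<integral>x. f x * \<phi> x \<partial>lebesgue)"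
  have ident1: "fst \<in> measurable (lebesgue \<Otimes>\<^sub>M lebesgue) (borel :: 'a measure)"
    by (rule measurable_compose[OF measurable_fst measurable_ident_lebesgue_borel])
  have ident2: "snd \<in> measurable (lebesgue \<Otimes>\<^sub>M lebesgue) (borel :: 'a measure)"
    by (rule measurable_compose[OF measurable_snd measurable_ident_lebesgue_borel])
  have char_meas: "(\<lambda>z. fourier_char (snd z \<bullet> fst z)) \<in> borel_measurable (lebesgue \<Otimes>\<^sub>M (lebesgue :: 'a measure))"
    by (rule measurable_compose[OF borel_measurable_inner[OF ident2 ident1] fourier_char_measurable])
  \<comment> \<open>\<open>D\<close> does not depend on R, whereas the bound tends to 0.\<close>
  have key: "ennreal ((cmod D)\<^sup>2) \<le> (\<integral>\<^sup>+ \<xi>. ennreal ((cmod (w \<xi> - truncated_fourier R f \<xi>))\<^sup>2) \<partial>lebesgue) *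
      (\<integral>\<^sup>+ \<xi>. ennreal ((\<Gamma> \<xi>)\<^sup>2) \<partial>lebesgue)" if R: "\<rho> \<le> R" for R
  proof -
    define B where "B = cball (0::'a) R"
    have [measurable]: "B \<in> sets lebesgue" by (simp add: B_def)
    have fB: "integrable lebesgue (\<lambda>x. indicator B x * cmod (f x))"
    proof (rule Bochner_Integration.integrable_bound)
      show "integrable lebesgue (\<lambda>x. indicator B x + (cmod (f x))\<^sup>2)"
        using lmeasurable_cball[of "0::'a" R] unfolding B_def[symmetric]
        by (intro Bochner_Integration.integrable_add f) (simp add: lmeasurable_iff_integrable)
      have "cmod z \<le> 1 + (cmod z)\<^sup>2" for z
        using zero_le_power2[of "cmod z - 1/2"] unfolding power2_diff by (simp add: power_divide)
      then show "AE x in lebesgue. norm (indicator B x * cmod (f x)) \<le> norm (indicator B x + (cmod (f x))\<^sup>2)"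
        by (auto split: split_indicator)
    qed measurable
    let ?F = "\<lambda>\<xi> x. complex_of_real (\<Gamma> \<xi>) * (indicator B x *\<^sub>R (fourier_char (x \<bullet> \<xi>) * f x))"
    have F_meas: "(\<lambda>z. indicator B (snd z) *\<^sub>R (fourier_char (snd z \<bullet> fst z) * f (snd z)))
        \<in> borel_measurable (lebesgue \<Otimes>\<^sub>M lebesgue)"
      by (intro borel_measurable_scaleR borel_measurable_times char_meas) measurable
    have intF: "integrable (lebesgue \<Otimes>\<^sub>M lebesgue) (\<lambda>(\<xi>, x). ?F \<xi> x)"
    proof (rule Bochner_Integration.integrable_bound)
      show "integrable (lebesgue \<Otimes>\<^sub>M lebesgue) (\<lambda>(\<xi>, x). \<Gamma> \<xi> * (indicator B x * cmod (f x)))"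
        by (rule integrable_tensor[OF LP.pair_sigma_finite_axioms \<Gamma>l fB])
      show "AE z in lebesgue \<Otimes>\<^sub>M lebesgue. norm (case z of (\<xi>, x) \<Rightarrow> ?F \<xi> x) \<le>
          norm (case z of (\<xi>, x) \<Rightarrow> \<Gamma> \<xi> * (indicator B x * cmod (f x)))"
        by (intro AE_I2) (auto simp: norm_mult abs_mult split: prod.split)
      show "(\<lambda>(\<xi>, x). ?F \<xi> x) \<in> borel_measurable (lebesgue \<Otimes>\<^sub>M lebesgue)"
        unfolding case_prod_beta by (intro borel_measurable_times F_meas) measurable
    qed
    have tf: "truncated_fourier R f \<xi> * of_real (\<Gamma> \<xi>) = \<kappa> * (\<integral>x. ?F \<xi> x \<partial>lebesgue)" for \<xi>
      unfolding truncated_fourier_def set_lebesgue_integral_def \<kappa>_def B_def fourier_char_def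
      by (subst integral_mult_right_zero) (simp only: mult_ac)
    have tf_int: "integrable lebesgue (\<lambda>\<xi>. truncated_fourier R f \<xi> * of_real (\<Gamma> \<xi>))"
      unfolding tf by (rule integrable_mult_right) (rule LP.integrable_fst[OF intF, unfolded prod.case])
    have "(\<integral>\<xi>. truncated_fourier R f \<xi> * of_real (\<Gamma> \<xi>) \<partial>lebesgue) = \<kappa> * (\<integral>\<xi>. \<integral>x. ?F \<xi> x \<partial>lebesgue \<partial>lebesgue)"
      unfolding tf by (rule integral_mult_right_zero)
    also have "(\<integral>\<xi>. \<integral>x. ?F \<xi> x \<partial>lebesgue \<partial>lebesgue) = (\<integral>x. \<integral>\<xi>. ?F \<xi> x \<partial>lebesgue \<partial>lebesgue)"
      using LP.Fubini_integral[OF intF] by simp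
    also have "\<dots> = (\<integral>x. f x * \<phi> x \<partial>lebesgue)"
    proof (intro Bochner_Integration.integral_cong refl)
      fix x
      have "(\<integral>\<xi>. ?F \<xi> x \<partial>lebesgue) = (\<integral>\<xi>. (indicator B x *\<^sub>R f x) * (fourier_char (x \<bullet> \<xi>) * of_real (\<Gamma> \<xi>)) \<partial>lebesgue)"
        by (intro Bochner_Integration.integral_cong refl) (simp add: scaleR_conv_of_real mult_ac)
      also have "\<dots> = (indicator B x *\<^sub>R f x) * \<phi> x"
        unfolding \<phi>' by (rule integral_mult_right_zero)
      also have "\<dots> = f x * \<phi> x"
        using supp[of x] R by (cases "x \<in> B") (auto simp: B_def)
      finally show "(\<integral>\<xi>. ?F \<xi> x \<partial>lebesgue) = f x * \<phi> x" .
    qed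
    finally have D: "D = (\<integral>\<xi>. (w \<xi> - truncated_fourier R f \<xi>) * of_real (\<Gamma> \<xi>) \<partial>lebesgue)"
      unfolding D_def left_diff_distrib using w\<Gamma> tf_int by simp
    have [measurable]: "truncated_fourier R f \<in> borel_measurable lebesgue"
    proof -
      have "(\<lambda>\<xi>. \<integral>x. indicator B x *\<^sub>R (fourier_char (x \<bullet> \<xi>) * f x) \<partial>lebesgue) \<in> borel_measurable lebesgue"
        by (rule L.borel_measurable_lebesgue_integral) (unfold case_prod_beta, rule F_meas)
      then show ?thesis
        unfolding truncated_fourier_def[abs_def] set_lebesgue_integral_def B_def fourier_char_def
        by (rule borel_measurable_times[OF borel_measurable_const])
    qed
    have "ennreal (cmod D) \<le> (\<integral>\<^sup>+ \<xi>. ennreal (cmod ((w \<xi> - truncated_fourier R f \<xi>) * of_real (\<Gamma> \<xi>))) \<partial>lebesgue)"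
      unfolding D by (rule integral_norm_bound_ennreal)
        (use w\<Gamma> tf_int in \<open>simp add: left_diff_distrib\<close>)
    also have "\<dots> = (\<integral>\<^sup>+ \<xi>. ennreal (cmod (w \<xi> - truncated_fourier R f \<xi>)) * ennreal (\<Gamma> \<xi>) \<partial>lebesgue)"
      using \<Gamma>(2) by (simp add: norm_mult ennreal_mult)
    finally have "(ennreal (cmod D))\<^sup>2 \<le> (\<integral>\<^sup>+ \<xi>. ennreal (cmod (w \<xi> - truncated_fourier R f \<xi>)) * ennreal (\<Gamma> \<xi>) \<partial>lebesgue)\<^sup>2"
      by (rule power_mono) simp
    also have "\<dots> \<le> (\<integral>\<^sup>+ \<xi>. (ennreal (cmod (w \<xi> - truncated_fourier R f \<xi>)))\<^sup>2 \<partial>lebesgue) * (\<integral>\<^sup>+ \<xi>. (ennreal (\<Gamma> \<xi>))\<^sup>2 \<partial>lebesgue)"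
      by (rule Cauchy_Schwarz_nn_integral) measurable
    finally show ?thesis using \<Gamma>(2) by (simp add: ennreal_power)
  qed
  let ?G = "\<integral>\<^sup>+ \<xi>. ennreal ((\<Gamma> \<xi>)\<^sup>2) \<partial>lebesgue"
  \<comment> \<open>Multiplication by an infinite constant is not continuous at 0 in the extended
    reals.\<close>
  have "?G \<noteq> \<infinity>"
    using \<Gamma>2 by (simp add: nn_integral_eq_integral)
  then have "((\<lambda>R. (\<integral>\<^sup>+ \<xi>. ennreal ((cmod (w \<xi> - truncated_fourier R f \<xi>))\<^sup>2) \<partial>lebesgue) * ?G) \<longlongrightarrow> 0 * ?G) at_top"
    by (intro tendsto_mult_ennreal lim tendsto_const) auto
  then have "ennreal ((cmod D)\<^sup>2) \<le> 0 * ?G"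
    by (rule tendsto_lowerbound) (auto intro!: eventually_mono[OF eventually_ge_at_top[of \<rho>]] key)
  then have "D = 0" by simp
  then show "(\<integral>\<xi>. w \<xi> * of_real (\<Gamma> \<xi>) \<partial>lebesgue) =
    of_real ((2 * pi) powr (- real DIM('a) / 2)) * (\<integral>x. f x * \<phi> x \<partial>lebesgue)"
    by (simp add: D_def \<kappa>_def)
qed

text \<open>By the pairing formula the data integral is, up to a positive constant, the integral of
  \<open>w\<close> against the dilated density. Its integrand has nonnegative real part, so it may
  be restricted to a cube at distance of order 1/l from the origin, where both factors have explicit
  lower bounds. The volume of the cube and the height of the density cancel in their powers of
  \<open>l\<close>, leaving the size l^(-\<alpha>) / ln(d l) of \<open>w\<close> there.\<close>

lemma data_lower_bound:
  fixes f w :: "'a::euclidean_space \<Rightarrow> complex" and \<gamma> c r :: real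
  assumes fp: "fourier_pos h g" and h0: "\<And>x. 4 \<le> \<bar>x\<bar> \<Longrightarrow> h x = 0"
    and ft: "has_fourier_transform f w"
    and pos: "AE \<xi> in lebesgue. 0 \<le> Re (w \<xi>)"
    and rc: "0 < r" "0 < c"
    and lower: "AE \<xi> in lebesgue. Re (w \<xi>) \<ge> c * norm \<xi> powr \<alpha> * inverse (ln (inverse (norm \<xi>))) * indicator (ball 0 r) \<xi>"
  obtains c' d where "0 < c'" "4 \<le> d"
    "\<And>l. 1 \<le> l \<Longrightarrow> c' * l powr (- \<alpha>) * inverse (ln (d * l)) \<le>
       Re (\<integral>x. f x * of_real (\<Prod>b\<in>Basis. h ((x \<bullet> b) / l)) \<partial>lebesgue)"
proof -
  define n where "n = real DIM('a)"
  have n: "1 \<le> n" using DIM_positive[where 'a='a] unfolding n_def by linarith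
  obtain b0 c0 where bc0: "0 < b0" "0 < c0" "\<And>\<xi>. \<bar>\<xi>\<bar> \<le> b0 \<Longrightarrow> c0 \<le> g \<xi>"
    using fp by (auto simp: fourier_pos_def)
  obtain M where M: "\<And>\<xi>. g \<xi> \<le> M" using fp by (auto simp: fourier_pos_def)
  have g: "integrable lborel g" "\<And>\<xi>. 0 \<le> g \<xi>" using fp by (auto simp: fourier_pos_def)
  \<comment> \<open>A point with coordinates in [0, b1] then has norm at most n b1, hence lies in
    the ball of radius \<open>r\<close> and has norm at most 1/2, where the logarithm is
    positive.\<close>
  define b1 where "b1 = min b0 (min (r / 2) (1 / 2) / n)"
  have b1: "0 < b1" "b1 \<le> b0" "n * b1 \<le> r / 2" "n * b1 \<le> 1 / 2"
  proof -
    show "0 < b1" "b1 \<le> b0" using bc0 rc n by (auto simp: b1_def)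
    have "n * b1 \<le> n * (min (r / 2) (1 / 2) / n)" using n by (intro mult_left_mono) (auto simp: b1_def)
    then have "n * b1 \<le> min (r / 2) (1 / 2)" using n by simp
    then show "n * b1 \<le> r / 2" "n * b1 \<le> 1 / 2" by auto
  qed
  \<comment> \<open>On the cube the norm lies between a/2 and n a; which end minimises its power
    depends on the sign of \<alpha>.\<close>
  define k0 where "k0 = min ((1/2) powr \<alpha>) (n powr \<alpha>)"
  have k0: "0 < k0" using n by (simp add: k0_def)
  define d where "d = 2 / b1"
  have "b1 \<le> n * b1" using n b1(1) by simp
  then have "b1 \<le> 1 / 2" using b1(4) by linarith
  then have d: "4 \<le> d" using b1(1) by (simp add: d_def field_simps)
  define \<kappa> where "\<kappa> = (2 * pi) powr (- n / 2)"
  have \<kappa>: "0 < \<kappa>" by (simp add: \<kappa>_def)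
  define c' where "c' = inverse \<kappa> * ((b1 / 2) ^ DIM('a) * c0 ^ DIM('a) * c * k0 * b1 powr \<alpha>)"
  have c': "0 < c'" using \<kappa> b1 bc0 rc k0 by (simp add: c'_def)
  have main: "c' * l powr (- \<alpha>) * inverse (ln (d * l)) \<le>
       Re (\<integral>x. f x * of_real (\<Prod>b\<in>Basis. h ((x \<bullet> b) / l)) \<partial>lebesgue)" if l: "1 \<le> l" for l
  proof -
    define \<Gamma> where "\<Gamma> = (\<lambda>\<xi>::'a. \<Prod>b\<in>Basis. l * g (l * (\<xi> \<bullet> b)))"
    have fpl: "fourier_pos (\<lambda>x. h (x / l)) (\<lambda>\<xi>. l * g (l * \<xi>))"
      using l by (intro fourier_pos_scale fp) auto
    then have gl: "integrable lborel (\<lambda>\<xi>. l * g (l * \<xi>))" by (simp add: fourier_pos_def)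
    have \<Gamma>: "integrable lborel \<Gamma>" unfolding \<Gamma>_def by (rule integrable_prod_Basis) (rule gl)
    have \<Gamma>0: "0 \<le> \<Gamma> \<xi>" for \<xi> unfolding \<Gamma>_def using l g by (intro prod_nonneg) auto
    have \<Gamma>M: "\<Gamma> \<xi> \<le> (\<Prod>b\<in>(Basis::'a set). l * M)" for \<xi>
      unfolding \<Gamma>_def using l g M by (intro prod_mono conjI mult_left_mono) auto
    have supp: "complex_of_real (\<Prod>b\<in>Basis. h ((x \<bullet> b) / l)) = 0" if "n * (4 * l) < norm x" for x :: 'a
    proof -
      have "\<exists>b\<in>Basis. 4 * l \<le> \<bar>x \<bullet> b\<bar>"
      proof (rule ccontr)
        assume "\<not> ?thesis"
        then have "(\<Sum>b\<in>Basis. \<bar>x \<bullet> b\<bar>) \<le> n * (4 * l)"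
          unfolding n_def by (intro sum_bounded_above) force
        with norm_le_l1[of x] that show False by simp
      qed
      then obtain b where b: "b \<in> Basis" "4 * l \<le> \<bar>x \<bullet> b\<bar>" by blast
      have "h ((x \<bullet> b) / l) = 0" using b l by (intro h0) (simp add: field_simps)
      then have "\<exists>b\<in>Basis. h ((x \<bullet> b) / l) = 0" using b by blast
      then show ?thesis by simp
    qed
    have \<phi>: "complex_of_real (\<Prod>b\<in>Basis. h ((x \<bullet> b) / l)) = (\<integral>\<xi>. fourier_char (x \<bullet> \<xi>) * of_real (\<Gamma> \<xi>) \<partial>lborel)" for x :: 'a
      unfolding \<Gamma>_def by (rule fourier_pos_prod_Basis[OF fpl])
    have pair: "(\<integral>\<xi>. w \<xi> * of_real (\<Gamma> \<xi>) \<partial>lebesgue) =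
      of_real \<kappa> * (\<integral>x. f x * of_real (\<Prod>b\<in>Basis. h ((x \<bullet> b) / l)) \<partial>lebesgue)"
      and int: "integrable lebesgue (\<lambda>\<xi>. w \<xi> * complex_of_real (\<Gamma> \<xi>))"
      using fourier_transform_pairing[where \<rho> = "n * (4 * l)", OF ft \<Gamma> \<Gamma>0 \<Gamma>M \<phi> supp] unfolding \<kappa>_def n_def by simp_all
    define a where "a = b1 / l"
    have a: "0 < a" "a \<le> b1" "l * a = b1" using l b1 by (auto simp: a_def field_simps)
    \<comment> \<open>The upper corner keeps \<open>l * (\<xi> \<bullet> b)\<close> below
      \<open>b1\<close>, where \<open>g \<ge> c0\<close>; the lower corner keeps ln(1/|\<xi>|) below
      ln(2/a) = ln(d l).\<close>
    define Q where "Q = cbox ((a / 2) *\<^sub>R One) (a *\<^sub>R (One::'a))"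
    define L where "L = c * (k0 * a powr \<alpha>) * inverse (ln (2 / a)) * (l * c0) ^ DIM('a)"
    have Q: "(\<integral>\<xi>. indicator Q \<xi> * L \<partial>lebesgue) = (a / 2) ^ DIM('a) * L"
      using a by (simp add: Q_def content_cbox_cases inner_simps)
    have Lle: "L \<le> Re (w \<xi>) * \<Gamma> \<xi>" if \<xi>: "\<xi> \<in> Q"
      and lo: "Re (w \<xi>) \<ge> c * norm \<xi> powr \<alpha> * inverse (ln (inverse (norm \<xi>))) * indicator (ball 0 r) \<xi>" for \<xi>
    proof -
      have comp: "a / 2 \<le> \<xi> \<bullet> b" "\<xi> \<bullet> b \<le> a" if "b \<in> Basis" for b
        using \<xi> that by (auto simp: Q_def mem_box inner_simps)
      have "norm \<xi> \<le> (\<Sum>b\<in>Basis. \<bar>\<xi> \<bullet> b\<bar>)" by (rule norm_le_l1)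
      also have "\<dots> \<le> n * a"
        unfolding n_def by (intro sum_bounded_above) (use comp a in force)
      finally have up: "norm \<xi> \<le> n * a" .
      obtain b :: 'a where b: "b \<in> Basis" using nonempty_Basis by blast
      have lw: "a / 2 \<le> norm \<xi>"
        using comp(1)[OF b] Basis_le_norm[OF b, of \<xi>] by linarith
      have na: "n * a \<le> n * b1" using a n by (intro mult_left_mono) auto
      have half: "norm \<xi> \<le> 1 / 2" and inr: "norm \<xi> < r" using up na b1 rc by linarith+
      have \<xi>0: "0 < norm \<xi>" using lw a by linarith
      have pw: "k0 * a powr \<alpha> \<le> norm \<xi> powr \<alpha>"
      proof (cases "0 \<le> \<alpha>")
        case True
        have "k0 * a powr \<alpha> \<le> (1/2) powr \<alpha> * a powr \<alpha>" by (intro mult_right_mono) (auto simp: k0_def)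
        also have "\<dots> = (a / 2) powr \<alpha>" using a by (simp flip: powr_mult)
        also have "\<dots> \<le> norm \<xi> powr \<alpha>" using lw a True by (intro powr_mono2) auto
        finally show ?thesis .
      next
        case False
        have "k0 * a powr \<alpha> \<le> n powr \<alpha> * a powr \<alpha>" by (intro mult_right_mono) (auto simp: k0_def)
        also have "\<dots> = (n * a) powr \<alpha>" using a n by (simp add: powr_mult)
        also have "\<dots> \<le> norm \<xi> powr \<alpha>" using up \<xi>0 False by (intro powr_mono2') auto
        finally show ?thesis .
      qed
      have "2 \<le> inverse (norm \<xi>)" using half \<xi>0 by (simp add: field_simps)
      then have ln0: "0 < ln (inverse (norm \<xi>))" by (intro ln_gt_zero) auto
      have "ln (inverse (norm \<xi>)) \<le> ln (2 / a)"
        using lw \<xi>0 a by (subst ln_le_cancel_iff) (auto simp: field_simps)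
      then have "inverse (ln (2 / a)) \<le> inverse (ln (inverse (norm \<xi>)))" and lna: "0 < ln (2 / a)"
        using ln0 by (auto intro: le_imp_inverse_le)
      then have "c * (k0 * a powr \<alpha>) * inverse (ln (2 / a)) \<le> c * norm \<xi> powr \<alpha> * inverse (ln (inverse (norm \<xi>)))"
        using pw rc k0 by (intro mult_mono mult_left_mono) auto
      also have "\<dots> \<le> Re (w \<xi>)" using lo inr by simp
      finally have 1: "c * (k0 * a powr \<alpha>) * inverse (ln (2 / a)) \<le> Re (w \<xi>)" .
      have "(\<Prod>b\<in>(Basis::'a set). l * c0) \<le> \<Gamma> \<xi>"
        unfolding \<Gamma>_def
      proof (intro prod_mono conjI mult_left_mono bc0(3))
        fix b :: 'a assume b: "b \<in> Basis"
        have "\<bar>l * (\<xi> \<bullet> b)\<bar> = l * (\<xi> \<bullet> b)" using comp(1)[OF b] a l by (simp add: abs_mult)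
        also have "\<dots> \<le> l * a" using comp(2)[OF b] l by (intro mult_left_mono) auto
        finally show "\<bar>l * (\<xi> \<bullet> b)\<bar> \<le> b0" using a b1 by simp
      qed (use l bc0 in auto)
      then have 2: "(l * c0) ^ DIM('a) \<le> \<Gamma> \<xi>" by simp
      have "0 \<le> c * (k0 * a powr \<alpha>) * inverse (ln (2 / a))" using rc k0 lna by simp
      then show ?thesis
        unfolding L_def using l bc0 by (intro mult_mono 1 2 order_trans[OF _ 1]) auto
    qed
    have "(a / 2) ^ DIM('a) * L \<le> (\<integral>\<xi>. Re (w \<xi>) * \<Gamma> \<xi> \<partial>lebesgue)"
      unfolding Q[symmetric]
    proof (rule integral_mono_AE)
      show "integrable lebesgue (\<lambda>\<xi>. indicator Q \<xi> * L)"
        using lmeasurable_cbox[of "(a / 2) *\<^sub>R One" "a *\<^sub>R (One::'a)"] unfolding Q_def[symmetric] lmeasurable_iff_integrable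
        by (rule integrable_mult_left)
      show "integrable lebesgue (\<lambda>\<xi>. Re (w \<xi>) * \<Gamma> \<xi>)"
        using integrable_Re[OF int] by simp
      show "AE \<xi> in lebesgue. indicator Q \<xi> * L \<le> Re (w \<xi>) * \<Gamma> \<xi>"
        using pos lower
      proof eventually_elim
        case (elim \<xi>)
        then show ?case using Lle[of \<xi>] \<Gamma>0[of \<xi>] by (cases "\<xi> \<in> Q") auto
      qed
    qed
    also have "\<dots> = Re (\<integral>\<xi>. w \<xi> * of_real (\<Gamma> \<xi>) \<partial>lebesgue)"
      using integral_Re[OF int] by simp
    also have "\<dots> = \<kappa> * Re (\<integral>x. f x * of_real (\<Prod>b\<in>Basis. h ((x \<bullet> b) / l)) \<partial>lebesgue)"
      unfolding pair by simp
    finally have "inverse \<kappa> * ((a / 2) ^ DIM('a) * L) \<le> Re (\<integral>x. f x * of_real (\<Prod>b\<in>Basis. h ((x \<bullet> b) / l)) \<partial>lebesgue)"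
      using \<kappa> by (simp add: field_simps)
    moreover have "inverse \<kappa> * ((a / 2) ^ DIM('a) * L) = c' * l powr (- \<alpha>) * inverse (ln (d * l))"
    proof -
      have 1: "(a / 2) ^ DIM('a) * (l * c0) ^ DIM('a) = (b1 / 2) ^ DIM('a) * c0 ^ DIM('a)"
      proof -
        have "a / 2 * (l * c0) = b1 / 2 * c0" by (simp flip: a(3))
        then show ?thesis by (metis power_mult_distrib)
      qed
      have 2: "a powr \<alpha> = b1 powr \<alpha> * l powr (- \<alpha>)"
        using b1 l by (simp add: a_def powr_divide powr_minus_divide)
      have 3: "2 / a = d * l" using l b1 by (simp add: a_def d_def)
      have "inverse \<kappa> * ((a / 2) ^ DIM('a) * L) =
        inverse \<kappa> * (((a / 2) ^ DIM('a) * (l * c0) ^ DIM('a)) * c * k0 * a powr \<alpha>) * inverse (ln (2 / a))"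
        unfolding L_def by (simp only: mult_ac)
      then show ?thesis unfolding 1 2 3 c'_def by (simp only: mult_ac)
    qed
    ultimately show ?thesis by simp
  qed
  show thesis by (rule that[OF c' d main])
qed

section \<open>Upper bound for the lifespan\<close>

lemma test_functionI:
  fixes \<psi> :: "real \<times> 'a::euclidean_space \<Rightarrow> real"
  assumes "smooth \<psi>" "\<And>z. z \<notin> cbox (-a, y) (a, x) \<Longrightarrow> \<psi> z = 0" "ereal a < T"
  shows "test_function T \<psi>"
  unfolding test_function_def
proof (intro conjI exI[of _ "cbox (-a, y) (a, x)"])
  have "ereal t < T" if "t \<le> a" for t
    by (rule order_le_less_trans[OF _ assms(3)]) (use that in simp)
  then show "\<forall>(t, x')\<in>cbox (-a, y) (a, x). ereal t < T"
    by (auto simp: cbox_Pair_eq)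
qed (use assms in auto)

text \<open>Young's inequality splits |u| \<psi>^(1/p) B into |u|^p \<psi> / p and B^p' / p'. The
  nonlinear term of the equation absorbs the former, and the latter is integrated over the support
  of \<psi>.\<close>

lemma weak_solution_data_bound:
  fixes \<psi> :: "real \<times> 'a::euclidean_space \<Rightarrow> real" and B :: real
  assumes p: "1 < p" "1 / p + 1 / p' = 1"
    and sol: "weak_solution p \<epsilon> u0 u1 T u"
    and \<psi>: "smooth \<psi>" "\<And>z. 0 \<le> \<psi> z" "\<And>z. \<psi> z \<le> 1"
    and supp: "\<And>z. z \<notin> cbox (-a, y) (a, x) \<Longrightarrow> \<psi> z = 0" and a: "ereal a < T"
    and flat: "\<And>x. time_deriv \<psi> (0, x) = 0"
    and B: "0 \<le> B" "\<And>z. \<bar>time_deriv (time_deriv \<psi>) z - time_deriv \<psi> z - laplacian \<psi> z\<bar> \<le> B * \<psi> z powr (1 / p)"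
  shows "\<epsilon> * Re (\<integral>x. (u0 x + u1 x) * of_real (\<psi> (0, x)) \<partial>lebesgue)
    \<le> B powr p' / p' * measure lborel (cbox (-a, y) (a, x))"
proof -
  define P where "P = (\<lambda>z. time_deriv (time_deriv \<psi>) z - time_deriv \<psi> z - laplacian \<psi> z)"
  define D where "D = (\<integral>x. (u0 x + u1 x) * complex_of_real (\<psi> (0, x)) \<partial>lebesgue)"
  define K where "K = cbox (-a, y) (a, x)"
  \<comment> \<open>The support of \<open>\<psi>\<close> may reach into \<open>t < 0\<close>; only its compact part \<open>K'\<close> lies in the time strip.\<close>
  define K' where "K' = K \<inter> {z. 0 \<le> fst z}"
  have p': "1 < p'"
  proof -
    have "1 / p' = 1 - 1 / p" "1 / p < 1" "0 < 1 / p" using p by auto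
    then have "0 < 1 / p'" "1 / p' < 1" by linarith+
    then show ?thesis by (simp add: divide_less_eq split: if_splits)
  qed
  have "closed {z :: real \<times> 'a. 0 \<le> fst z}"
    by (intro closed_Collect_le continuous_intros)
  then have cK': "compact K'" unfolding K'_def K_def by (intro compact_Int_closed compact_cbox)
  have "ereal t < T" if "t \<le> a" for t
    by (rule order_le_less_trans[OF _ a]) (use that in simp)
  then have strip: "z \<in> time_strip T \<longleftrightarrow> z \<in> K'" if "z \<in> K" for z
    using that by (cases z) (auto simp: time_strip_def K'_def K_def cbox_Pair_eq)
  have K'sub: "K' \<subseteq> time_strip T" using strip by (auto simp: K'_def)
  have \<psi>K: "\<psi> z = 0" if "z \<notin> K" for z using supp that by (simp add: K_def)
  \<comment> \<open>The assumed bound vanishes with \<psi>, since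
    \<open>0 powr (1 / p) = 0\<close>.\<close>
  have PK: "P z = 0" if "z \<notin> K" for z
    using B(2)[of z] \<psi>K[OF that] by (simp add: P_def)
  have "set_integrable lebesgue K' (\<lambda>z. cmod (u z) powr p)"
    using sol cK' K'sub by (auto simp: weak_solution_def Lp_loc_def)
  then have uK: "integrable lebesgue (\<lambda>z. indicator K' z * cmod (u z) powr p)"
    by (simp add: set_integrable_def)
  have \<psi>m: "\<psi> \<in> borel_measurable lebesgue"
    using borel_measurable_continuous_onI[OF smooth_continuous[OF \<psi>(1)]] by (simp add: measurable_completion)
  define m where "m = (\<lambda>z. indicator K' z * (cmod (u z) powr p * \<psi> z))"
  \<comment> \<open>Absorption subtracts \<open>I\<close> from both sides, so it must be finite;
    local integrability on the compact \<open>K'\<close> provides this.\<close>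
  have m: "integrable lebesgue m"
  proof (rule Bochner_Integration.integrable_bound[OF uK])
    have "(\<lambda>z. (indicator K' z * cmod (u z) powr p) * \<psi> z) \<in> borel_measurable lebesgue"
      using borel_measurable_integrable[OF uK] \<psi>m by (rule borel_measurable_times)
    then show "m \<in> borel_measurable lebesgue" by (simp add: m_def mult.assoc)
    show "AE z in lebesgue. norm (m z) \<le> norm (indicator K' z * cmod (u z) powr p)"
      using \<psi> by (intro AE_I2) (auto simp: m_def abs_mult intro!: mult_left_mono mult_right_le_one_le)
  qed
  define I where "I = integral\<^sup>L lebesgue m"
  have I: "0 \<le> I" unfolding I_def m_def using \<psi> by (intro Bochner_Integration.integral_nonneg) auto
  have eqI: "(LINT z:time_strip T|lebesgue. complex_of_real (cmod (u z) powr p * \<psi> z)) = of_real I"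
  proof -
    have "indicator (time_strip T) z *\<^sub>R complex_of_real (cmod (u z) powr p * \<psi> z) = of_real (m z)" for z
      using strip[of z] \<psi>K[of z] by (cases "z \<in> K") (auto simp: m_def split: split_indicator)
    then show ?thesis
      unfolding set_lebesgue_integral_def I_def by (simp only: integral_complex_of_real)
  qed
  define J where "J = (LINT z:time_strip T|lebesgue. u z * of_real (P z))"
  have K'l: "K' \<in> lmeasurable" by (rule lmeasurable_compact[OF cK'])
  have "cmod J \<le> (\<integral>z. norm (indicator (time_strip T) z *\<^sub>R (u z * of_real (P z))) \<partial>lebesgue)"
    unfolding J_def set_lebesgue_integral_def by (rule integral_norm_bound)
  \<comment> \<open>\<open>integral_mono'\<close> asks for an integrable nonnegative majorant, so it
    also covers a left-hand integral with the default value 0.\<close>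
  also have "\<dots> \<le> (\<integral>z. m z / p + indicator K' z * (B powr p' / p') \<partial>lebesgue)"
  proof (rule integral_mono')
    show "integrable lebesgue (\<lambda>z. m z / p + indicator K' z * (B powr p' / p'))"
      using K'l by (intro Bochner_Integration.integrable_add integrable_divide m integrable_mult_left)
        (auto simp: lmeasurable_iff_integrable)
    show "norm (indicator (time_strip T) z *\<^sub>R (u z * of_real (P z))) \<le> m z / p + indicator K' z * (B powr p' / p')" for z
    proof (cases "z \<in> K'")
      case True
      then have "z \<in> time_strip T" using K'sub by auto
      then have "norm (indicator (time_strip T) z *\<^sub>R (u z * of_real (P z))) = cmod (u z) * \<bar>P z\<bar>"
        by (simp add: norm_mult)
      also have "\<dots> \<le> cmod (u z) * (B * \<psi> z powr (1 / p))"
        unfolding P_def by (intro mult_left_mono B) auto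
      also have "\<dots> = (cmod (u z) * \<psi> z powr (1 / p)) * B" by simp
      also have "\<dots> \<le> (cmod (u z) * \<psi> z powr (1 / p)) powr p / p + B powr p' / p'"
        using p p' B by (intro Youngs_inequality) auto
      also have "(cmod (u z) * \<psi> z powr (1 / p)) powr p = cmod (u z) powr p * \<psi> z"
        using p \<psi>(2)[of z] by (simp add: powr_mult powr_powr)
      finally show ?thesis using True by (simp add: m_def)
    next
      case False
      then have "indicator (time_strip T) z *\<^sub>R (u z * of_real (P z)) = 0"
        using strip[of z] PK[of z] by (cases "z \<in> K") auto
      then show ?thesis using False unfolding m_def by (simp only: norm_zero) simp
    qed
    show "0 \<le> m z / p + indicator K' z * (B powr p' / p')" for z
      using \<psi> p p' by (simp add: m_def)
  qed
  also have "\<dots> = I / p + measure lebesgue K' * (B powr p' / p')"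
    using m K'l by (subst Bochner_Integration.integral_add) (auto simp: lmeasurable_iff_integrable I_def lmeasure_integral)
  also have "\<dots> \<le> I + measure lebesgue K * (B powr p' / p')"
  proof (intro add_mono mult_right_mono)
    show "I / p \<le> I" using I p by (simp add: divide_le_eq mult_le_cancel_left1)
    show "measure lebesgue K' \<le> measure lebesgue K"
      using K'l by (intro measure_mono_fmeasurable) (auto simp: K'_def K_def)
  qed (use p' in simp)
  finally have J: "cmod J \<le> I + measure lebesgue K * (B powr p' / p')" .
  have "test_function T \<psi>" by (rule test_functionI[OF \<psi>(1) supp a])
  then have "(LINT z:time_strip T|lebesgue. complex_of_real (cmod (u z) powr p * \<psi> z))
        + of_real \<epsilon> * D - of_real \<epsilon> * (LINT x|lebesgue. u0 x * of_real (time_deriv \<psi> (0, x))) = J"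
    using sol unfolding weak_solution_def D_def J_def P_def by blast
  then have "of_real I + of_real \<epsilon> * D = J"
    unfolding eqI by (simp add: flat)
  \<comment> \<open>\<open>I\<close> is real, so only the real part of the possibly complex data
    term is compared.\<close>
  then have "I + \<epsilon> * Re D \<le> cmod J"
    using complex_Re_le_cmod[of J] by auto
  with J have "\<epsilon> * Re D \<le> measure lebesgue K * (B powr p' / p')" by linarith
  then show ?thesis unfolding D_def K_def by (simp add: mult.commute)
qed

text \<open>The two bounds on the data integral, with spatial scale l = sqrt R, compare R^(n/4 -
  \<gamma>/2 - \<delta>) with R^(1 - p' + n/2). The difference of the exponents is the positive
  number \<open>\<theta>\<close>, so R^\<theta> is at most a constant over \<epsilon>.\<close>

lemma weak_solution_time_bound:
  fixes u0 u1 w :: "'a::euclidean_space \<Rightarrow> complex" and p p' \<gamma> \<delta> c r :: real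
  assumes p: "1 < p" "1 / p + 1 / p' = 1"
    and ft: "has_fourier_transform (\<lambda>x. u0 x + u1 x) w"
    and pos: "AE \<xi> in lebesgue. 0 \<le> Re (w \<xi>)"
    and rc: "0 < r" "0 < c"
    and lower: "AE \<xi> in lebesgue. Re (w \<xi>) \<ge>
      c * norm \<xi> powr (- real DIM('a) / 2 + \<gamma>) * inverse (ln (inverse (norm \<xi>))) * indicator (ball 0 r) \<xi>"
    and \<delta>: "0 < \<delta>" "\<delta> < p' - 1 - \<gamma> / 2 - real DIM('a) / 4"
  obtains C where "0 < C"
    "\<And>\<epsilon> T u R. 0 < \<epsilon> \<Longrightarrow> weak_solution p \<epsilon> u0 u1 T u \<Longrightarrow> 1 \<le> R \<Longrightarrow> ereal (4 * R) < T \<Longrightarrow>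
      R \<le> C * \<epsilon> powr (- (1 / (p' - 1 - \<gamma> / 2 - real DIM('a) / 4 - \<delta>)))"
proof -
  define n where "n = real DIM('a)"
  define \<alpha> where "\<alpha> = - n / 2 + \<gamma>"
  define \<theta> where "\<theta> = p' - 1 - \<gamma> / 2 - n / 4 - \<delta>"
  have \<theta>: "0 < \<theta>" using \<delta> by (simp add: \<theta>_def n_def)
  obtain \<psi> :: "real \<Rightarrow> real \<times> 'a \<Rightarrow> real" and C h g where C: "0 < C" and fp: "fourier_pos h g" and h0: "\<And>x. 4 \<le> \<bar>x\<bar> \<Longrightarrow> h x = 0"
    and \<psi>: "\<And>R. smooth (\<psi> R)" "\<And>R z. 0 \<le> \<psi> R z" "\<And>R z. \<psi> R z \<le> 1"
    "\<And>R t x. 1 \<le> R \<Longrightarrow> 4 * R < \<bar>t\<bar> \<Longrightarrow> \<psi> R (t, x) = 0"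
    "\<And>R t x b. 1 \<le> R \<Longrightarrow> b \<in> Basis \<Longrightarrow> 4 * sqrt R < \<bar>x \<bullet> b\<bar> \<Longrightarrow> \<psi> R (t, x) = 0"
    "\<And>R x. 1 \<le> R \<Longrightarrow> time_deriv (\<psi> R) (0, x) = 0"
    "\<And>R x. \<psi> R (0, x) = (\<Prod>b\<in>Basis. h ((x \<bullet> b) / sqrt R))"
    "\<And>R z. 1 \<le> R \<Longrightarrow> \<bar>time_deriv (time_deriv (\<psi> R)) z - time_deriv (\<psi> R) z - laplacian (\<psi> R) z\<bar>
       \<le> C / R * \<psi> R z powr (1 / p)"
    by (rule test_function_family[OF p(1), where 'a='a]) (rule that)
  obtain c' d where c': "0 < c'" "4 \<le> d" and data:
    "\<And>l. 1 \<le> l \<Longrightarrow> c' * l powr (- \<alpha>) * inverse (ln (d * l)) \<le>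
       Re (\<integral>x. (u0 x + u1 x) * of_real (\<Prod>b\<in>Basis. h ((x \<bullet> b) / l)) \<partial>lebesgue)"
    by (rule data_lower_bound[OF fp h0 ft pos rc lower[folded n_def, folded \<alpha>_def]]) (assumption, rule that)
  have p': "0 < p'"
  proof -
    have "1 / p' = 1 - 1 / p" "1 / p < 1" using p by auto
    then have "0 < 1 / p'" by linarith
    then show ?thesis by simp
  qed
  \<comment> \<open>The support box has volume 8 R (8 sqrt R)^n; its powers of R are kept apart from
    \<open>A\<close>.\<close>
  define A where "A = C powr p' / p' * (8 * 8 ^ DIM('a))"
  define c'' where "c'' = c' * (2 * \<delta>) * d powr (- (2 * \<delta>))"
  have A: "0 < A" using C p' by (simp add: A_def)
  have c'': "0 < c''" using c' \<delta> by (simp add: c''_def)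
  define C1 where "C1 = (A / c'') powr (1 / \<theta>)"
  have C1: "0 < C1" using A c'' by (simp add: C1_def)
  have main: "R \<le> C1 * \<epsilon> powr (- (1 / \<theta>))"
    if \<epsilon>: "0 < \<epsilon>" and sol: "weak_solution p \<epsilon> u0 u1 T u" and R: "1 \<le> R" and T: "ereal (4 * R) < T" for \<epsilon> T u R
  proof -
    define l where "l = sqrt R"
    have l: "1 \<le> l" "0 < l" using R by (auto simp: l_def)
    have lR: "l powr e = R powr (e / 2)" for e
      using R by (simp add: l_def powr_half_sqrt[symmetric] powr_powr)
    let ?y = "- ((4 * l) *\<^sub>R One) :: 'a" and ?x = "(4 * l) *\<^sub>R One :: 'a"
    have supp: "\<psi> R z = 0" if "z \<notin> cbox (-(4 * R), ?y) (4 * R, ?x)" for z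
    proof (cases z)
      case (Pair t x)
      show ?thesis
      proof (cases "4 * R < \<bar>t\<bar>")
        case False
        with that Pair have "x \<notin> cbox ?y ?x" by (auto simp: cbox_Pair_eq)
        then obtain b where "b \<in> Basis" "4 * l < \<bar>x \<bullet> b\<bar>"
          by (auto simp: mem_box inner_simps)
        then show ?thesis using \<psi>(5)[OF R] Pair by (simp add: l_def)
      qed (use \<psi>(4)[OF R] Pair in simp)
    qed
    have vol: "measure lborel (cbox (-(4 * R), ?y) (4 * R, ?x)) = 8 * R * (8 * l) ^ DIM('a)"
    proof -
      have "measure lborel (cbox ?y ?x) = (8 * l) ^ DIM('a)"
        using l by (simp add: content_cbox_cases inner_simps)
      moreover have "measure lborel (cbox (-(4 * R)) (4 * R)) = 8 * R" using R by simp
      ultimately show ?thesis by (simp only: content_Pair)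
    qed
    have "\<epsilon> * Re (\<integral>x. (u0 x + u1 x) * of_real (\<psi> R (0, x)) \<partial>lebesgue)
        \<le> (C / R) powr p' / p' * (8 * R * (8 * l) ^ DIM('a))"
      unfolding vol[symmetric]
      by (rule weak_solution_data_bound[OF p sol \<psi>(1-3) supp T \<psi>(6)[OF R] _ \<psi>(8)[OF R]]) (use C R in auto)
    also have "\<dots> = A * R powr (1 - p' + n / 2)"
    proof -
      have "l ^ DIM('a) = R powr (n / 2)" using lR[of n] l by (simp add: n_def powr_realpow)
      moreover have "(C / R) powr p' * R = C powr p' * R powr (1 - p')"
        using C R by (simp add: powr_divide powr_diff)
      ultimately show ?thesis
        using R by (simp add: A_def power_mult_distrib powr_add mult_ac)
    qed
    finally have up: "\<epsilon> * Re (\<integral>x. (u0 x + u1 x) * of_real (\<psi> R (0, x)) \<partial>lebesgue) \<le> A * R powr (1 - p' + n / 2)" .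
    have "c'' * R powr (- \<alpha> / 2 - \<delta>) = c' * l powr (- \<alpha>) * (2 * \<delta> * (d * l) powr (- (2 * \<delta>)))"
      using lR[of "- \<alpha>"] lR[of "- (2 * \<delta>)"] c' l R by (simp add: c''_def powr_mult powr_diff powr_minus_divide)
    also have "\<dots> \<le> c' * l powr (- \<alpha>) * inverse (ln (d * l))"
    proof (intro mult_left_mono)
      have "4 * 1 \<le> d * l" using c' l by (intro mult_mono) auto
      then have dl: "4 \<le> d * l" by simp
      \<comment> \<open>The exponent 2 \<delta> in \<open>l\<close> is \<delta> in R; here the
        lifespan exponent loses \<delta>.\<close>
      have "ln (d * l) \<le> (d * l) powr (2 * \<delta>) / (2 * \<delta>)"
        using dl \<delta> by (intro ln_powr_bound) auto
      moreover have "0 < ln (d * l)" using dl by (intro ln_gt_zero) linarith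
      ultimately have "inverse ((d * l) powr (2 * \<delta>) / (2 * \<delta>)) \<le> inverse (ln (d * l))"
        by (intro le_imp_inverse_le)
      then show "2 * \<delta> * (d * l) powr (- (2 * \<delta>)) \<le> inverse (ln (d * l))"
        by (simp add: powr_minus_divide)
    qed (use c' in auto)
    also have "\<dots> \<le> Re (\<integral>x. (u0 x + u1 x) * of_real (\<psi> R (0, x)) \<partial>lebesgue)"
      using data[OF l(1)] by (simp only: \<psi>(7) l_def)
    finally have "\<epsilon> * (c'' * R powr (- \<alpha> / 2 - \<delta>)) \<le> A * R powr (1 - p' + n / 2)"
      using up \<epsilon> by (meson mult_left_mono order_trans less_imp_le)
    moreover have "- \<alpha> / 2 - \<delta> = \<theta> + (1 - p' + n / 2)"
      by (simp add: \<theta>_def \<alpha>_def field_simps)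
    then have "R powr (- \<alpha> / 2 - \<delta>) = R powr \<theta> * R powr (1 - p' + n / 2)"
      by (simp only: powr_add)
    ultimately have "(\<epsilon> * c'' * R powr \<theta>) * R powr (1 - p' + n / 2) \<le> A * R powr (1 - p' + n / 2)"
      by (simp add: mult.assoc)
    then have "\<epsilon> * c'' * R powr \<theta> \<le> A" using R by simp
    then have "R powr \<theta> \<le> A / c'' * inverse \<epsilon>"
      using \<epsilon> c'' by (simp add: field_simps)
    then have "(R powr \<theta>) powr (1 / \<theta>) \<le> (A / c'' * inverse \<epsilon>) powr (1 / \<theta>)"
      using \<theta> by (intro powr_mono2) auto
    moreover have "(R powr \<theta>) powr (1 / \<theta>) = R" using R \<theta> by (simp add: powr_powr)
    moreover have "(A / c'' * inverse \<epsilon>) powr (1 / \<theta>) = C1 * \<epsilon> powr (- (1 / \<theta>))"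
      using \<epsilon> A c'' unfolding C1_def by (subst powr_mult) (auto simp: powr_minus inverse_powr)
    ultimately show ?thesis by simp
  qed
  show thesis using that[OF C1] main unfolding \<theta>_def n_def by blast
qed

text \<open>A solution on [0, T) admits every test scale R \<ge> 1 with 4 R < T, and each such R is
  bounded by a power of 1/\<epsilon>; hence so is T. A global solution would contradict this finite
  bound.\<close>

theorem theorem2:
  fixes s \<gamma> p p' c r :: real
    and u0 u1 w :: "real ^ 'n \<Rightarrow> complex"
  assumes "0 < s" and "s \<le> 1" and "0 < \<gamma>"
    and "1 < p" and "p < 1 + 4 / (real CARD('n) + 2 * \<gamma>)"
    and "1 / p + 1 / p' = 1"
    and "u0 \<in> sobolev s \<inter> hom_sobolev_neg \<gamma>"
    and "u1 \<in> L2_space \<inter> hom_sobolev_neg \<gamma>"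
    and "has_fourier_transform (\<lambda>x. u0 x + u1 x) w"
    and "AE \<xi> in lebesgue. Im (w \<xi>) = 0 \<and> 0 \<le> Re (w \<xi>)"
    and "0 < r" and "0 < c"
    and "AE \<xi> in lebesgue. Re (w \<xi>) \<ge>
           c * norm \<xi> powr (- real CARD('n) / 2 + \<gamma>) * inverse (ln (inverse (norm \<xi>)))
             * indicator (ball 0 r) \<xi>"
  shows "(\<forall>\<^sub>F \<epsilon> in at_right 0. \<not> (\<exists>u. weak_solution p \<epsilon> u0 u1 \<infinity> u)) \<and>
    (\<forall>\<^sub>F \<delta> in at_right 0. \<exists>C>0. \<forall>\<^sub>F \<epsilon> in at_right 0. \<forall>T>0.
       (\<exists>u. weak_solution p \<epsilon> u0 u1 T u) \<longrightarrow>
         T \<le> ereal (C * \<epsilon> powr (- (1 / (p' - 1 - \<gamma> / 2 - real CARD('n) / 4 - \<delta>)))))"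
proof -
  let ?\<kappa> = "p' - 1 - \<gamma> / 2 - real CARD('n) / 4"
  have \<kappa>: "0 < ?\<kappa>"
  proof -
    define q where "q = real CARD('n) + 2 * \<gamma>"
    have q: "0 < q" using \<open>0 < \<gamma>\<close> by (simp add: q_def add_nonneg_pos)
    have "p - 1 < 4 / q" using assms(5) by (simp add: q_def)
    then have "(p - 1) * q < 4" using q by (simp only: pos_less_divide_eq)
    then have "q / 4 < 1 / (p - 1)" using \<open>1 < p\<close> by (simp add: field_simps)
    moreover have "p' - 1 = 1 / (p - 1)"
    proof -
      have "p' \<noteq> 0" using assms(4,6) by auto
      then have "p' * (p - 1) = p" using assms(4,6) by (simp add: field_simps)
      then show ?thesis using \<open>1 < p\<close> by (simp add: field_simps)
    qed
    ultimately show ?thesis by (simp add: q_def)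
  qed
  have pos: "AE \<xi> in lebesgue. 0 \<le> Re (w \<xi>)" using assms(10) by eventually_elim simp
  have bound: "\<exists>C>0. \<forall>\<epsilon>\<in>{0<..<1}. \<forall>T. (\<exists>u. weak_solution p \<epsilon> u0 u1 T u) \<longrightarrow> T \<le> ereal (C * \<epsilon> powr (- (1 / (?\<kappa> - \<delta>))))"
    if \<delta>: "\<delta> \<in> {0<..<?\<kappa>}" for \<delta>
  proof -
    obtain C where C: "0 < C" and main: "\<And>\<epsilon> T u R. 0 < \<epsilon> \<Longrightarrow> weak_solution p \<epsilon> u0 u1 T u \<Longrightarrow> 1 \<le> R \<Longrightarrow> ereal (4 * R) < T \<Longrightarrow>
      R \<le> C * \<epsilon> powr (- (1 / (?\<kappa> - \<delta>)))"
      using weak_solution_time_bound[OF assms(4,6,9) pos assms(11,12), of \<gamma> \<delta>] assms(13) \<delta> by auto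
    have "T \<le> ereal (4 * (C + 1) * \<epsilon> powr (- (1 / (?\<kappa> - \<delta>))))"
      if \<epsilon>: "\<epsilon> \<in> {0<..<1}" and sol: "weak_solution p \<epsilon> u0 u1 T u" for \<epsilon> T u
    proof (rule ccontr)
      \<comment> \<open>The scale R = (C + 1) e is admissible since \<epsilon> < 1 gives e \<ge> 1,
        and it violates R \<le> C e; hence the constant 4 (C + 1).\<close>
      define e where "e = \<epsilon> powr (- (1 / (?\<kappa> - \<delta>)))"
      assume "\<not> T \<le> ereal (4 * (C + 1) * \<epsilon> powr (- (1 / (?\<kappa> - \<delta>))))"
      then have T: "ereal (4 * ((C + 1) * e)) < T" by (simp only: e_def mult.assoc not_le)
      have "\<epsilon> powr 0 \<le> e" unfolding e_def using \<epsilon> \<delta> by (intro powr_mono') auto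
      then have e: "1 \<le> e" using \<epsilon> by simp
      have "1 * 1 \<le> (C + 1) * e" using C e by (intro mult_mono) auto
      then have "(C + 1) * e \<le> C * e"
        using main[OF _ sol _ T] \<epsilon> unfolding e_def by simp
      then show False using e by (simp add: algebra_simps)
    qed
    then show ?thesis using C by (intro exI[of _ "4 * (C + 1)"]) auto
  qed
  show ?thesis
  proof
    \<comment> \<open>For nonexistence any single admissible \<delta> suffices, as every finite
      bound excludes T = \<infinity>.\<close>
    have "?\<kappa> / 2 \<in> {0<..<?\<kappa>}" using \<kappa> by simp
    from bound[OF this] obtain C where "\<And>\<epsilon> T u. \<epsilon> \<in> {0<..<1} \<Longrightarrow> weak_solution p \<epsilon> u0 u1 T u \<Longrightarrow>
        T \<le> ereal (C * \<epsilon> powr (- (1 / (?\<kappa> - ?\<kappa> / 2))))"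
      by blast
    then have "\<not> (\<exists>u. weak_solution p \<epsilon> u0 u1 \<infinity> u)" if "\<epsilon> \<in> {0<..<1}" for \<epsilon>
      using that by fastforce
    then show "\<forall>\<^sub>F \<epsilon> in at_right 0. \<not> (\<exists>u. weak_solution p \<epsilon> u0 u1 \<infinity> u)"
      by (rule eventually_at_rightI) auto
    show "\<forall>\<^sub>F \<delta> in at_right 0. \<exists>C>0. \<forall>\<^sub>F \<epsilon> in at_right 0. \<forall>T>0.
       (\<exists>u. weak_solution p \<epsilon> u0 u1 T u) \<longrightarrow> T \<le> ereal (C * \<epsilon> powr (- (1 / (?\<kappa> - \<delta>))))"
    proof (rule eventually_at_rightI[OF _ \<kappa>])
      fix \<delta> assume "\<delta> \<in> {0<..<?\<kappa>}"
      from bound[OF this] obtain C where C: "0 < C" "\<And>\<epsilon> T. \<epsilon> \<in> {0<..<1} \<Longrightarrow> (\<exists>u. weak_solution p \<epsilon> u0 u1 T u) \<Longrightarrow>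
          T \<le> ereal (C * \<epsilon> powr (- (1 / (?\<kappa> - \<delta>))))"
        by blast
      have "\<forall>\<^sub>F \<epsilon> in at_right 0. \<forall>T>0. (\<exists>u. weak_solution p \<epsilon> u0 u1 T u) \<longrightarrow>
          T \<le> ereal (C * \<epsilon> powr (- (1 / (?\<kappa> - \<delta>))))"
        by (rule eventually_at_rightI[of 0 1]) (use C(2) in auto)
      with C(1) show "\<exists>C>0. \<forall>\<^sub>F \<epsilon> in at_right 0. \<forall>T>0. (\<exists>u. weak_solution p \<epsilon> u0 u1 T u) \<longrightarrow>
          T \<le> ereal (C * \<epsilon> powr (- (1 / (?\<kappa> - \<delta>))))"
        by blast
    qed
  qed
qed

end
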